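(* Let $q$ be an odd prime power such that either $q\equiv 3\pmod 4$, or $q$ is a prime with $q\neq 5$. Then $\operatorname{Aut}(\mathbb{F}_q^2)=\operatorname{AffAut}(\mathbb{F}_q^2)$; that is, every integral automorphism of $\mathbb{F}_q^2$ is an automorphism of the affine plane $\mathbb{F}_q^2$.
   Context: Let $q$ be an odd prime power and $\mathbb{F}_q$ the field with $q$ elements. $\square_q$ denotes the set of squares in $\mathbb{F}_q$, including $0$. For $x=(x_1,x_2)\in\mathbb{F}_q^2$ put $N(x)=x_1^2+x_2^2$. Points $x,y\in\mathbb{F}_q^2$ are at integral distance if $N(x-y)\in\square_q$. An integral automorphism is a bijection $\phi:\mathbb{F}_q^2\to\mathbb{F}_q^2$ preserving integral distances, i.e. mapping pairs of points at integral distance to pairs of points at integral distance; the group of these is $\operatorname{Aut}(\mathbb{F}_q^2)$. An affine integral automorphism is an integral automorphism that is also an automorphism of the affine plane $\mathbb{F}_q^2$ (it maps affine lines to affine lines); the group of these is $\operatorname{AffAut}(\mathbb{F}_q^2)\le\operatorname{Aut}(\mathbb{F}_q^2)$. *)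

theory Defs
  imports "HOL-Library.Cardinality" "HOL-Library.Product_Plus" "HOL-Computational_Algebra.Primes"
begin

text \<open>The plane over a field is the product type \<open>'a \<times> 'a\<close>, with componentwise operations.\<close>

definition squares :: "'a::field set" where
  "squares = range (\<lambda>w. w\<^sup>2)"

fun plane_norm :: "'a::field \<times> 'a \<Rightarrow> 'a" where
  "plane_norm (x1, x2) = x1\<^sup>2 + x2\<^sup>2"

definition integral_distance :: "'a::field \<times> 'a \<Rightarrow> 'a \<times> 'a \<Rightarrow> bool" where
  "integral_distance x y \<longleftrightarrow> plane_norm (x - y) \<in> squares"

text \<open>
  Integral distances only need to be preserved in one direction. On a finite plane the converse
  direction follows, because a bijection preserving them permutes the finitely many pairs of
  points at integral distance.
\<close>

definition integral_automorphisms :: "('a::field \<times> 'a \<Rightarrow> 'a \<times> 'a) set" where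
  "integral_automorphisms =
    {\<phi>. bij \<phi> \<and> (\<forall>x y. integral_distance x y \<longrightarrow> integral_distance (\<phi> x) (\<phi> y))}"

definition affine_lines :: "('a::field \<times> 'a) set set" where
  "affine_lines =
    {{(p1 + t * v1, p2 + t * v2) | t. True} | p1 p2 v1 v2. (v1, v2) \<noteq> (0, 0)}"

text \<open>
  Automorphisms of the affine plane as an incidence structure (collineations): they may be
  semi-affine rather than affine when the field has nontrivial automorphisms.
\<close>

definition plane_automorphisms :: "('a::field \<times> 'a \<Rightarrow> 'a \<times> 'a) set" where
  "plane_automorphisms = {\<phi>. bij \<phi> \<and> (\<forall>L\<in>affine_lines. \<phi> ` L \<in> affine_lines)}"

definition affine_integral_automorphisms :: "('a::field \<times> 'a \<Rightarrow> 'a \<times> 'a) set" where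
  "affine_integral_automorphisms = integral_automorphisms \<inter> plane_automorphisms"

end

theory Submission
  imports Defs "HOL-Algebra.Algebraic_Closure_Type"
begin

hide_const (open) Divisibility.prime

text \<open>
  If \<open>q \<equiv> 3 (mod 4)\<close>, identify the plane with the field with \<open>q\<^sup>2\<close> elements; then
  \<open>N z = z ^ (q + 1)\<close>, so with \<open>m = (q\<^sup>2 - 1) div 2\<close> an integral automorphism \<open>f\<close> satisfies
  \<open>(f x - f y) ^ m = (x - y) ^ m\<close>. If \<open>f 0 = 0\<close> this forces \<open>f z = c * z ^ d\<close>, and such a map
  sends lines through the origin to lines through the origin. The origin can be any point.

  If \<open>q \<equiv> 1 (mod 4)\<close> is a prime, take coordinates with \<open>N = u v\<close> and put \<open>h = (q - 1) div 2\<close>.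
  The function \<open>N (P - Q) ^ h + [u P = u Q] + [v P = v Q]\<close> depends only on whether \<open>P = Q\<close> and
  whether \<open>P, Q\<close> are at integral distance, so the operator \<open>kern_op\<close> with this kernel commutes with
  integral automorphisms. Let \<open>W\<close> be the set of all \<open>kern_op g\<close> where \<open>g\<close> sums to zero. The
  functions \<open>f\<close> in the image of \<open>kern_op\<close> such that \<open>\<Sum>P. f P * w1 P * w2 P = 0\<close> for all
  \<open>w1, w2\<close> in \<open>W\<close> form a space that is invariant under integral automorphisms, and it consists
  exactly of the affine functions when \<open>q > 5\<close>. To see this, compute enough elements of \<open>W\<close>
  and of the kernel of \<open>kern_op\<close> to force all moments of \<open>f\<close> but three to vanish. Hence the coordinates of an integral automorphism are affine.
\<close>

subsection \<open>Finite subfields and Carlitz's theorem\<close>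

text \<open>X is prime, so a power of X has only the obvious divisors. If \<open>p\<close> vanishes
  at 0, a factor X cancels from \<open>p\<close>; otherwise X divides the cofactor and cancels
  there.\<close>

lemma dvd_linear_power:
  fixes p :: "'k::field poly"
  assumes "p dvd [:0, 1:] ^ m"
  shows "\<exists>k u. p = smult u ([:0, 1:] ^ k)"
  using assms
proof (induction m arbitrary: p)
  case 0
  then obtain c where "p = [:c:]" by (auto simp: is_unit_poly_iff)
  thus ?case by (intro exI[of _ 0] exI[of _ c]) simp
next
  case (Suc m)
  show ?case
  proof (cases "poly p 0 = 0")
    case True
    then obtain s where s: "p = [:0, 1:] * s" by (auto simp: poly_eq_0_iff_dvd elim!: dvdE)
    with Suc.prems have "s dvd [:0, 1:] ^ m"
      by (simp only: power_Suc dvd_times_left_cancel_iff) auto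
    with Suc.IH obtain k u where "s = smult u ([:0, 1:] ^ k)" by blast
    with s show ?thesis by (intro exI[of _ "Suc k"] exI[of _ u]) simp
  next
    case False
    obtain s where s: "p * s = [:0, 1:] ^ Suc m" using Suc.prems by (metis dvdE)
    hence "poly p 0 * poly s 0 = 0"
      by (metis poly_mult poly_power poly_pCons mult_zero_left add.right_neutral power_0_Suc)
    with False obtain s' where "s = [:0, 1:] * s'" by (auto simp: poly_eq_0_iff_dvd elim!: dvdE)
    with s have "[:0, 1:] * (p * s') = [:0, 1:] * [:0, 1:] ^ m" by (simp only: power_Suc mult_ac)
    hence "p * s' = [:0, 1:] ^ m" by (simp only: mult_cancel_left) auto
    thus ?thesis using Suc.IH by (metis dvdI)
  qed
qed

text \<open>A set rather than a type, so that the plane embedded in an algebraic closure is an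
  instance. Finiteness supplies negatives and inverses, since translations and multiplications by
  nonzero elements are injective.\<close>

locale finite_subfield =
  fixes Z :: "'k::field set"
  assumes finite_Z: "finite Z"
    and zero_mem: "0 \<in> Z"
    and one_mem: "1 \<in> Z"
    and add_mem: "x \<in> Z \<Longrightarrow> y \<in> Z \<Longrightarrow> x + y \<in> Z"
    and mult_mem: "x \<in> Z \<Longrightarrow> y \<in> Z \<Longrightarrow> x * y \<in> Z"
begin

lemma of_nat_card_eq_0: "of_nat (card Z) = (0::'k)"
proof -
  have "bij_betw (\<lambda>x. x + 1) Z Z"
    using add_mem one_mem
      by (simp add: bij_betw_def endo_inj_surj finite_Z image_subset_iff inj_on_def)
  hence "(\<Sum>x\<in>Z. x + 1) = (\<Sum>x\<in>Z. x)"
    by (rule sum.reindex_bij_betw)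
  thus ?thesis by (simp add: sum.distrib)
qed

lemma card_ge_2: "card Z \<ge> 2"
  using card_mono[OF finite_Z, of "{0, 1}"] zero_mem one_mem by auto

lemma bij_betw_mult:
  assumes "a \<in> Z" "a \<noteq> 0"
  shows "bij_betw (\<lambda>x. a * x) Z Z" "bij_betw (\<lambda>x. a * x) (Z - {0}) (Z - {0})"
  using mult_mem assms
  by (simp_all add: bij_betw_def endo_inj_surj finite_Z image_subset_iff inj_on_def)

lemma power_card_minus_1:
  assumes "a \<in> Z" "a \<noteq> 0"
  shows "a ^ (card Z - 1) = 1"
proof -
  have "(\<Prod>x\<in>Z - {0}. a * x) = (\<Prod>x\<in>Z - {0}. x)"
    by (rule prod.reindex_bij_betw[OF bij_betw_mult(2)[OF assms]])
  moreover have "(\<Prod>x\<in>Z - {0}. x) \<noteq> 0"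
    using finite_Z by simp
  ultimately show ?thesis
    using finite_Z zero_mem by (simp add: prod.distrib)
qed

lemma power_card: "a \<in> Z \<Longrightarrow> a ^ card Z = a"
  using power_card_minus_1[of a] card_ge_2
  by (cases "a = 0") (auto simp: power_eq_if)

text \<open>Substituting \<open>a * x\<close> for \<open>x\<close> multiplies the sum by
  \<open>a ^ k\<close>, so it vanishes once some nonzero \<open>a\<close> has
  \<open>a ^ k \<noteq> 1\<close>. If \<open>card Z - 1\<close> does not divide \<open>k\<close>,
  such an \<open>a\<close> exists, because X^r - 1 has at most \<open>r\<close> roots,
  \<open>r\<close> being the remainder of \<open>k\<close>.\<close>

lemma sum_power:
  "(\<Sum>x\<in>Z. x ^ k) = (if k > 0 \<and> (card Z - 1) dvd k then - 1 else 0)"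
proof (cases "k > 0")
  case False
  thus ?thesis using of_nat_card_eq_0 by simp
next
  case k: True
  define n where "n = card Z - 1"
  have n: "n > 0" "card Z = Suc n" using card_ge_2 by (auto simp: n_def)
  show ?thesis
  proof (cases "n dvd k")
    case True
    have "(\<Sum>x\<in>Z. x ^ k) = (\<Sum>x\<in>Z - {0}. x ^ k)"
      using finite_Z k by (intro sum.mono_neutral_right) auto
    also have "\<dots> = (\<Sum>x\<in>Z - {0}. 1)"
      using True power_card_minus_1
      by (intro sum.cong) (auto simp: power_mult n_def elim!: dvdE)
    also have "\<dots> = of_nat n"
      using finite_Z zero_mem by (simp add: n_def)
    also have "\<dots> = - 1"
      using of_nat_card_eq_0 n by (simp add: add_eq_0_iff)
    finally show ?thesis using True k by (simp add: n_def)
  next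
    case False
    define r where "r = k mod n"
    have r: "0 < r" "r < n" using False n by (auto simp: r_def mod_greater_zero_iff_not_dvd)
    have "\<exists>a\<in>Z - {0}. a ^ r \<noteq> 1"
    proof (rule ccontr)
      assume "\<not> ?thesis"
      hence sub: "Z - {0} \<subseteq> {x. poly (Polynomial.monom 1 r - 1) x = 0}" by (auto simp: poly_monom)
      have nz: "Polynomial.monom 1 r - 1 \<noteq> (0 :: 'k poly)"
        using r
          by (metis degree_1 degree_monom_eq eq_iff_diff_eq_0 less_numeral_extra(3) one_neq_zero)
      have "n = card (Z - {0})" using finite_Z zero_mem by (simp add: n_def)
      also have "\<dots> \<le> card {x. poly (Polynomial.monom 1 r - 1) x = (0::'k)}"
        using sub nz by (intro card_mono poly_roots_finite)
      also have "\<dots> \<le> Polynomial.degree (Polynomial.monom 1 r - 1 :: 'k poly)"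
        by (rule card_poly_roots_bound[OF nz])
      also have "\<dots> \<le> r"
        by (intro degree_diff_le) (auto simp: degree_monom_le)
      finally show False using r by simp
    qed
    then obtain a where a: "a \<in> Z" "a \<noteq> 0" "a ^ r \<noteq> 1" by auto
    have "a ^ k = a ^ r * (a ^ n) ^ (k div n)"
      by (simp flip: power_mult power_add add: r_def)
    hence ak: "a ^ k \<noteq> 1" using a power_card_minus_1 by (simp add: n_def)
    have "(\<Sum>x\<in>Z. x ^ k) = (\<Sum>x\<in>Z. (a * x) ^ k)"
      by (rule sum.reindex_bij_betw[OF bij_betw_mult(1)[OF a(1,2)], symmetric])
    also have "\<dots> = a ^ k * (\<Sum>x\<in>Z. x ^ k)"
      by (simp add: power_mult_distrib sum_distrib_left)
    finally show ?thesis using ak False by (simp add: n_def)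
  qed
qed

section \<open>Convolutions of powers\<close>

lemma sum_diff_power_mult_power_expand:
  "(\<Sum>x\<in>Z. (a - x) ^ m * x ^ i)
    = (\<Sum>k\<le>m. (-1) ^ (m - k) * of_nat (m choose k) * a ^ k * (\<Sum>x\<in>Z. x ^ (m - k + i)))"
proof -
  have "(a - x) ^ m * x ^ i
      = (\<Sum>k\<le>m. (-1) ^ (m - k) * of_nat (m choose k) * a ^ k * x ^ (m - k + i))" for x
  proof -
    have "(- x) ^ j = (-1) ^ j * x ^ j" for j by (rule power_minus)
    thus ?thesis
      unfolding diff_conv_add_uminus binomial_ring sum_distrib_right
      by (intro sum.cong refl) (simp only: power_add mult_ac)
  qed
  thus ?thesis
    by (simp only: sum_distrib_left) (rule sum.swap)
qed

text \<open>Only exponents that are positive multiples of \<open>2 * m\<close> contribute to the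
  expansion. The exponents \<open>m - k + i\<close> are positive and below \<open>4 * m\<close>,
  which leaves \<open>2 * m\<close>, at \<open>k = i - m\<close>.\<close>

lemma sum_diff_power_mult_power:
  assumes "m \<le> i" "i \<le> 2 * m" "card Z = 2 * m + 1"
  shows "(\<Sum>x\<in>Z. (a - x) ^ m * x ^ i)
    = - ((-1) ^ (2 * m - i) * of_nat (m choose (i - m)) * a ^ (i - m))"
proof -
  have m: "m > 0" using card_ge_2 assms(3) by simp
  have "(\<Sum>x\<in>Z. (a - x) ^ m * x ^ i) 
      = (\<Sum>k\<le>m. if k = i - m then - ((-1) ^ (m - k) * of_nat (m choose k) * a ^ k) else 0)"
    unfolding sum_diff_power_mult_power_expand
  proof (intro sum.cong refl)
    fix k assume k: "k \<in> {..m}"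
    have "(2 * m dvd m - k + i) = (k = i - m)"
    proof
      assume "2 * m dvd m - k + i"
      then obtain c where c: "m - k + i = 2 * m * c" by (elim dvdE)
      have "c < 2"
      proof (rule ccontr)
        assume "\<not> c < 2"
        hence "2 * m * 2 \<le> 2 * m * c" by (intro mult_left_mono) auto
        moreover have "m - k + i \<le> m + i" by simp
        ultimately show False using c assms(2) m by linarith
      qed
      moreover have "c \<noteq> 0"
      proof
        assume "c = 0"
        with c have "m - k + i = 0" by simp
        thus False using assms(1) m by simp
      qed
      ultimately have "c = 1" by simp
      thus "k = i - m" using c k assms by auto
    next
      assume "k = i - m"
      hence "m - k + i = 2 * m" using assms by auto
      thus "2 * m dvd m - k + i" by simp
    qed
    moreover have "m - k + i > 0" using assms m by auto
    ultimately show "(-1) ^ (m - k) * of_nat (m choose k) * a ^ k * (\<Sum>x\<in>Z. x ^ (m - k + i))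
        = (if k = i - m then - ((-1) ^ (m - k) * of_nat (m choose k) * a ^ k) else 0)"
      using assms(3) by (simp add: sum_power)
  qed
  also have "\<dots> = - ((-1) ^ (2 * m - i) * of_nat (m choose (i - m)) * a ^ (i - m))"
    using assms by (simp add: mult_2)
  finally show ?thesis .
qed

text \<open>All exponents in the expansion stay below \<open>2 * m\<close>, so every power sum is
  0.\<close>

lemma sum_diff_power_mult_power_eq_0:
  assumes "i < m" "card Z = 2 * m + 1"
  shows "(\<Sum>x\<in>Z. (a - x) ^ m * x ^ i) = 0"
  unfolding sum_diff_power_mult_power_expand
proof (intro sum.neutral ballI)
  fix k assume k: "k \<in> {..m}"
  have "m - k + i < 2 * m" using assms by auto
  hence "\<not> (m - k + i > 0 \<and> 2 * m dvd m - k + i)" by (auto dest: dvd_imp_le)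
  thus "(-1) ^ (m - k) * of_nat (m choose k) * a ^ k * (\<Sum>x\<in>Z. x ^ (m - k + i)) = 0"
    by (simp only: sum_power assms(2) add_diff_cancel_right' if_False mult_zero_right)
qed

text \<open>
  A special case of Carlitz's theorem. Both \<open>f\<close> and \<open>f ^ (m - 1)\<close> are polynomials of degree
  at most \<open>m\<close>, so their product has degree less than \<open>card Z\<close> and equals \<open>X ^ m\<close>
  as a polynomial. Hence \<open>f\<close> divides \<open>X ^ m\<close>.
\<close>

lemma paley_automorphism_monomial:
  assumes card: "card Z = 2 * m + 1"
    and f_mem: "\<And>x. x \<in> Z \<Longrightarrow> f x \<in> Z"
    and f_inj: "inj_on f Z"
    and f_0: "f 0 = 0"
    and f_power: "\<And>x y. x \<in> Z \<Longrightarrow> y \<in> Z \<Longrightarrow> (f x - f y) ^ m = (x - y) ^ m"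
  obtains c d where "\<And>x. x \<in> Z \<Longrightarrow> f x = c * x ^ d"
proof -
  have m: "m > 0" using card_ge_2 card by simp
  have m_nz: "of_nat m \<noteq> (0::'k)"
    using of_nat_card_eq_0 card by (auto simp: algebra_simps)
  have bij: "bij_betw f Z Z"
    using f_mem f_inj by (simp add: bij_betw_def endo_inj_surj finite_Z image_subset_iff)
  \<comment> \<open>Convolution with the \<open>m\<close>-th power takes \<open>y ^ (m + k)\<close>
    to a nonzero multiple of the \<open>k\<close>-th power. Since \<open>f\<close> permutes
    \<open>Z\<close> and preserves \<open>(x - y) ^ m\<close>, this writes \<open>f x ^ k\<close> as
    a combination of the \<open>(x - y) ^ m\<close>, each of degree \<open>m\<close> in
    \<open>x\<close>.\<close>
  have poly_rep: "\<exists>p. Polynomial.degree p \<le> m \<and> (\<forall>x\<in>Z. poly p x = f x ^ k)"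
    if k: "k \<le> m" "of_nat (m choose k) \<noteq> (0::'k)" for k
  proof -
    define C where "C = - ((-1) ^ (m - k) * of_nat (m choose k) :: 'k)"
    have C: "C \<noteq> 0" using k by (simp add: C_def)
    define p where "p = smult (inverse C) (\<Sum>y\<in>Z. smult (f y ^ (m + k)) ([:- y, 1:] ^ m))"
    have "Polynomial.degree p \<le> m"
      unfolding p_def
    proof (intro degree_smult_le[THEN order_trans] degree_sum_le finite_Z)
      fix y
      show "Polynomial.degree ([:- y, 1:] ^ m) \<le> m"
        using degree_power_le[of "[:- y, 1:]" m] by simp
    qed
    moreover have "poly p x = f x ^ k" if x: "x \<in> Z" for x
    proof -
      have "(\<Sum>y\<in>Z. (x - y) ^ m * f y ^ (m + k)) = (\<Sum>y\<in>Z. (f x - f y) ^ m * f y ^ (m + k))"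
        using x f_power by simp
      also have "\<dots> = (\<Sum>y\<in>Z. (f x - y) ^ m * y ^ (m + k))"
        by (rule sum.reindex_bij_betw[OF bij])
      also have "\<dots> = C * f x ^ k"
        using sum_diff_power_mult_power[of m "m + k" "f x"] k card by (simp add: C_def)
      finally show ?thesis
        using C by (simp add: p_def poly_sum mult.commute)
    qed
    ultimately show ?thesis by blast
  qed
  \<comment> \<open>The exponents 1 and \<open>m - 1\<close> are available because both binomial
    coefficients equal \<open>m\<close>, which is nonzero in the field.\<close>
  have "m choose (m - 1) = m" using m by (cases m) simp_all
  with poly_rep[of 1] poly_rep[of "m - 1"] m m_nz obtain p r where
    p: "Polynomial.degree p \<le> m" "\<And>x. x \<in> Z \<Longrightarrow> poly p x = f x" and
    r: "Polynomial.degree r \<le> m" "\<And>x. x \<in> Z \<Longrightarrow> poly r x = f x ^ (m - 1)"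
    by auto
  have "p * r = Polynomial.monom 1 m"
  proof (rule poly_eqI_degree)
    show "poly (p * r) x = poly (Polynomial.monom 1 m) x" if "x \<in> Z" for x
      using p r f_power[OF that zero_mem] that m f_0 by (simp add: poly_monom power_eq_if)
    show "Polynomial.degree (p * r) < card Z"
      using degree_mult_le[of p r] p r card by linarith
    show "Polynomial.degree (Polynomial.monom 1 m :: 'k poly) < card Z"
      using card by (simp add: degree_monom_eq)
  qed
  hence "p dvd [:0, 1:] ^ m" by (metis dvdI monom_altdef smult_1_left)
  then obtain k u where "p = smult u ([:0, 1:] ^ k)"
    using dvd_linear_power by blast
  hence "f x = u * x ^ k" if "x \<in> Z" for x
    using p(2)[OF that] by simp
  thus ?thesis using that by blast
qed

end

subsection \<open>Integral automorphisms and lines\<close>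

lemma finite_subfield_UNIV: "finite_subfield (UNIV :: 'a::{field,finite} set)"
  by standard auto

lemma two_neq_0_of_odd_card:
  assumes "odd CARD('a::{field,finite})"
  shows "(2::'a) \<noteq> 0"
proof
  assume two: "(2::'a) = 0"
  obtain h where "CARD('a) = 2 * h + 1" using assms by (elim oddE)
  moreover have "of_nat CARD('a) = (0::'a)"
    by (rule finite_subfield.of_nat_card_eq_0[OF finite_subfield_UNIV])
  ultimately show False using two by simp
qed

text \<open>Every nonzero square is a root of X^h - 1. Squaring has fibres of at most two elements,
  so there are at least \<open>h\<close> nonzero squares, and a nonsquare root would be one root too
  many.\<close>

lemma euler_criterion:
  fixes x :: "'a::{field,finite}"
  assumes card: "CARD('a) = 2 * h + 1" and "x \<noteq> 0"
  shows "x ^ h = (if x \<in> squares then 1 else - 1)"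
proof -
  have power_2h: "y ^ (2 * h) = 1" if "y \<noteq> 0" for y :: 'a
    using finite_subfield.power_card_minus_1[OF finite_subfield_UNIV, of y] that card by simp
  have square: "y ^ h = 1" if "y \<in> squares - {0}" for y :: 'a
    using that power_2h by (auto simp: squares_def simp flip: power_mult)
  have "x ^ h = 1 \<or> x ^ h = - 1"
    using power_2h[OF \<open>x \<noteq> 0\<close>] by (simp add: mult.commute[of 2] power_mult power2_eq_1_iff)
  moreover have "x \<in> squares" if "x ^ h = 1"
  proof (rule ccontr)
    assume x: "x \<notin> squares"
    have h: "h > 0"
      using card card_mono[of "UNIV" "{0, 1::'a}"] by simp
    define p where "p = Polynomial.monom 1 h - (1 :: 'a poly)"
    have nz: "p \<noteq> 0"
      using h unfolding p_def
      by (metis degree_1 degree_monom_eq eq_iff_diff_eq_0 less_numeral_extra(3) one_neq_zero)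
    have "insert x (squares - {0}) \<subseteq> {y. poly p y = 0}"
      using square that by (auto simp: p_def poly_monom)
    hence "card (insert x (squares - {0})) \<le> card {y. poly p y = 0}"
      by (intro card_mono) auto
    also have "\<dots> \<le> Polynomial.degree p" by (rule card_poly_roots_bound[OF nz])
    also have "\<dots> \<le> h"
      unfolding p_def by (intro degree_diff_le) (auto simp: degree_monom_le)
    finally have "card (squares - {0 :: 'a}) < h" using x by simp
    moreover have "2 * h \<le> 2 * card (squares - {0 :: 'a})"
    proof -
      have "card {w. w\<^sup>2 = s} \<le> 2" for s :: 'a
      proof (cases "\<exists>w. w\<^sup>2 = s")
        case True
        then obtain w where "w\<^sup>2 = s" by blast
        hence "{w. w\<^sup>2 = s} \<subseteq> {w, - w}" by (auto simp: power2_eq_iff)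
        hence "card {w. w\<^sup>2 = s} \<le> card {w, - w}" by (intro card_mono) auto
        also have "\<dots> \<le> 2" by (simp add: card_insert_if)
        finally show ?thesis .
      qed auto
      hence "(\<Sum>s\<in>squares - {0}. card {w::'a. w\<^sup>2 = s}) \<le> (\<Sum>s\<in>squares - {0::'a}. 2)"
        by (intro sum_mono)
      moreover have "UNIV - {0} = (\<Union>s\<in>squares - {0}. {w::'a. w\<^sup>2 = s})"
        by (auto simp: squares_def)
      hence "2 * h \<le> (\<Sum>s\<in>squares - {0}. card {w::'a. w\<^sup>2 = s})"
        using card_UN_le[of "squares - {0}" "\<lambda>s. {w::'a. w\<^sup>2 = s}"] card
        by (metis (no_types, lifting) add_diff_cancel_right' card_Diff_singleton finite iso_tuple_UNIV_I)
      ultimately show ?thesis by simp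
    qed
    ultimately show False by simp
  qed
  ultimately show ?thesis using square \<open>x \<noteq> 0\<close> by auto
qed

text \<open>The injection induced on pairs maps the finite set \<open>E\<close> into itself, hence
  onto itself.\<close>

lemma integral_automorphism_iff:
  fixes \<phi> :: "'a::{field,finite} \<times> 'a \<Rightarrow> 'a \<times> 'a"
  assumes "\<phi> \<in> integral_automorphisms"
  shows "integral_distance (\<phi> x) (\<phi> y) \<longleftrightarrow> integral_distance x y"
proof -
  define E :: "(('a \<times> 'a) \<times> ('a \<times> 'a)) set" where "E = {(x, y). integral_distance x y}"
  have inj: "inj \<phi>" and E: "map_prod \<phi> \<phi> ` E \<subseteq> E"
    using assms by (auto simp: integral_automorphisms_def bij_def E_def)
  have "inj_on (map_prod \<phi> \<phi>) E"
    using inj by (auto simp: inj_on_def)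
  hence "map_prod \<phi> \<phi> ` E = E"
    using E by (intro endo_inj_surj) auto
  moreover have "(\<phi> x, \<phi> y) \<in> map_prod \<phi> \<phi> ` E \<longleftrightarrow> (x, y) \<in> E"
    using inj_image_mem_iff[OF prod.inj_map[OF inj inj], of "(x, y)" E] by simp
  ultimately have "(\<phi> x, \<phi> y) \<in> E \<longleftrightarrow> (x, y) \<in> E" by simp
  thus ?thesis by (simp add: E_def)
qed

definition scale :: "'a::field \<Rightarrow> 'a \<times> 'a \<Rightarrow> 'a \<times> 'a" where
  "scale t V = (t * fst V, t * snd V)"

lemma affine_lines_altdef: "affine_lines = {range (\<lambda>t. P + scale t V) | P V. V \<noteq> 0}"
  unfolding affine_lines_def scale_def
  by (simp add: full_SetCompr_eq zero_prod_def)

lemma inj_scale: "V \<noteq> 0 \<Longrightarrow> inj (\<lambda>t. P + scale t V)"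
  by (cases V) (auto simp: inj_def scale_def zero_prod_def)

text \<open>Mapping each line into a line suffices: both have \<open>CARD('a)\<close> points, so the
  inclusion is an equality. Leaving \<open>s\<close> an arbitrary function of \<open>t\<close>
  admits semi-affine maps.\<close>

lemma plane_automorphismI:
  fixes \<phi> :: "'a::{field,finite} \<times> 'a \<Rightarrow> 'a \<times> 'a"
  assumes bij: "bij \<phi>"
    and line: "\<And>P V. \<exists>V'. \<forall>t. \<exists>s. \<phi> (P + scale t V) = \<phi> P + scale s V'"
  shows "\<phi> \<in> plane_automorphisms"
  unfolding plane_automorphisms_def
proof (intro CollectI conjI ballI bij)
  fix L :: "('a \<times> 'a) set" assume "L \<in> affine_lines"
  then obtain P V where L: "L = range (\<lambda>t. P + scale t V)" and V: "V \<noteq> 0"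
    by (auto simp: affine_lines_altdef)
  from line obtain V' where V': "\<forall>t. \<exists>s. \<phi> (P + scale t V) = \<phi> P + scale s V'" by blast
  let ?L' = "range (\<lambda>s. \<phi> P + scale s V')"
  have sub: "\<phi> ` L \<subseteq> ?L'"
    unfolding L using V' by blast
  have "card (\<phi> ` L) = card L"
    using bij by (intro card_image) (auto simp: bij_def intro: inj_on_subset)
  also have "card L = CARD('a)"
    unfolding L by (rule card_image[OF inj_scale[OF V]])
  finally have card_L: "card (\<phi> ` L) = CARD('a)" .
  have "V' \<noteq> 0"
  proof
    assume "V' = 0"
    hence "\<phi> ` L \<subseteq> {\<phi> P}" using sub by (auto simp: scale_def zero_prod_def)
    hence "CARD('a) \<le> card {\<phi> P}" using card_L by (metis card_mono finite)
    moreover have "card {0, 1::'a} \<le> CARD('a)" by (intro card_mono) auto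
    ultimately show False by simp
  qed
  moreover have "\<phi> ` L = ?L'"
    using sub card_L card_image[OF inj_scale[OF \<open>V' \<noteq> 0\<close>]]
    by (intro card_subset_eq) simp_all
  ultimately show "\<phi> ` L \<in> affine_lines"
    unfolding affine_lines_altdef by blast
qed

subsection \<open>Fields of order congruent to 3 modulo 4\<close>

text \<open>The field elements are the roots of X^q - X. In product form, translating
  \<open>z\<close> by a field element merely permutes the factors.\<close>

lemma prod_diff_to_ac:
  fixes z :: "'a::{field,finite} alg_closure"
  shows "(\<Prod>a\<in>UNIV. z - to_ac a) = z ^ CARD('a) - z"
proof -
  let ?q = "CARD('a)"
  define p where "p = (\<Prod>a\<in>(UNIV::'a set). [:- to_ac a, 1:])"
  have q: "?q > 1" using card_mono[of UNIV "{0, 1::'a}"] by simp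
  have "p = Polynomial.monom 1 ?q - [:0, 1:]"
  proof (rule poly_eqI_degree_lead_coeff[where n = ?q and A = "range (to_ac :: 'a \<Rightarrow> _)"])
    have deg: "Polynomial.degree (\<Prod>a\<in>A. [:- to_ac a, 1:]) = card A" if "finite A" for A :: "'a set"
      by (subst degree_prod_eq_sum_degree) auto
    hence deg_p: "Polynomial.degree p = ?q" by (simp add: p_def)
    have "Polynomial.lead_coeff p = 1" by (simp add: p_def lead_coeff_prod)
    thus "Polynomial.coeff p ?q = Polynomial.coeff (Polynomial.monom 1 ?q - [:0, 1:]) ?q"
      using q deg_p by (simp add: coeff_pCons split: nat.split)
    show "Polynomial.degree p \<le> ?q" using deg_p by simp
    show "Polynomial.degree (Polynomial.monom 1 ?q - [:0, 1::'a alg_closure:]) \<le> ?q"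
      using q by (intro degree_diff_le) (auto simp: degree_monom_le)
    show "card (range (to_ac :: 'a \<Rightarrow> _)) \<ge> ?q" by (simp add: card_image inj_to_ac)
    fix x :: "'a alg_closure" assume "x \<in> range (to_ac :: 'a \<Rightarrow> _)"
    then obtain a where x: "x = to_ac a" by blast
    have "poly p x = 0"
      unfolding p_def poly_prod x by (rule prod_zero) auto
    moreover have "to_ac a ^ ?q = to_ac a"
      using finite_subfield.power_card[OF finite_subfield_UNIV, of a] by (metis UNIV_I to_ac_power)
    ultimately show "poly p x = poly (Polynomial.monom 1 ?q - [:0, 1:]) x"
      by (simp add: x poly_monom)
  qed
  hence "poly p z = z ^ ?q - z" by (simp add: poly_monom)
  thus ?thesis by (simp add: p_def poly_prod)
qed

theorem integral_automorphism_card_3_mod_4: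
  fixes \<phi> :: "'a::{field,finite} \<times> 'a \<Rightarrow> 'a \<times> 'a"
  assumes q: "CARD('a) mod 4 = 3" and \<phi>: "\<phi> \<in> integral_automorphisms"
  shows "\<phi> \<in> plane_automorphisms"
proof (rule plane_automorphismI)
  let ?q = "CARD('a)"
  show "bij \<phi>" using \<phi> by (simp add: integral_automorphisms_def)
  hence inj: "inj \<phi>" by (simp add: bij_def)
  fix P V :: "'a \<times> 'a"
  obtain k where k: "?q = 4 * k + 3" using q by (metis mult_div_mod_eq)
  define h where "h = 2 * k + 1"
  have qh: "?q = 2 * h + 1" using k by (simp add: h_def)
  have two: "(2::'a) \<noteq> 0" by (rule two_neq_0_of_odd_card) (simp add: qh)
  obtain \<iota> :: "'a alg_closure" where \<iota>: "\<iota> ^ 2 = - 1"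
    using nth_root_exists[of 2 "- 1 :: 'a alg_closure"] by auto
  \<comment> \<open>Here the residue 3 modulo 4 enters: -1 is raised to the odd power
    \<open>2 * k + 1\<close>, so Frobenius conjugates \<iota>.\<close>
  have "?q = 2 * (2 * k + 1) + 1" using k by simp
  hence "\<iota> ^ ?q = (\<iota> ^ 2) ^ (2 * k + 1) * \<iota>"
    by (simp only: power_add power_mult power_one_right)
  also have "\<dots> = - \<iota>" unfolding \<iota> by simp
  finally have \<iota>_q: "\<iota> ^ ?q = - \<iota>" .
  \<comment> \<open>\<open>e\<close> identifies the plane with the field of q^2 elements generated
    by \<iota>; \<open>plane_norm\<close> becomes the norm down to the base field.\<close>
  define e where "e = (\<lambda>(x, y). to_ac x + \<iota> * to_ac y)"
  have e_diff: "e (A - B) = e A - e B" for A B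
    by (cases A; cases B) (simp add: e_def algebra_simps)
  have e_scale: "e (scale t A) = to_ac t * e A" for t A
    by (cases A) (simp add: e_def scale_def algebra_simps)
  have e_power_q: "e (x, y) ^ ?q = to_ac x - \<iota> * to_ac y" for x y
  proof -
    have "e (x, y) ^ ?q - e (x, y) = (\<Prod>a\<in>UNIV. e (x, y) - to_ac a)"
      by (simp add: prod_diff_to_ac)
    \<comment> \<open>Translation by \<open>x\<close> permutes the factors, so only the power of
      \<open>\<iota> * to_ac y\<close> remains to be computed.\<close>
    also have "\<dots> = (\<Prod>a\<in>UNIV. e (x, y) - to_ac (a + x))"
      by (rule prod.reindex_bij_witness[of _ "\<lambda>a. a + x" "\<lambda>a. a - x"]) auto
    also have "\<dots> = (\<Prod>a\<in>UNIV. \<iota> * to_ac y - to_ac a)"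
      by (simp add: e_def algebra_simps)
    also have "\<dots> = (\<iota> * to_ac y) ^ ?q - \<iota> * to_ac y"
      by (simp add: prod_diff_to_ac)
    also have "(\<iota> * to_ac y) ^ ?q = - \<iota> * to_ac y"
      using finite_subfield.power_card[OF finite_subfield_UNIV, of y]
      by (simp add: power_mult_distrib \<iota>_q flip: to_ac_power)
    finally show ?thesis by (simp add: e_def algebra_simps)
  qed
  have e_norm: "e A ^ (?q + 1) = to_ac (plane_norm A)" for A
  proof (cases A)
    case (Pair x y)
    have "e A ^ (?q + 1) = (to_ac x - \<iota> * to_ac y) * (to_ac x + \<iota> * to_ac y)"
      using e_power_q[of x y] Pair by (simp add: e_def)
    also have "\<dots> = to_ac x ^ 2 - \<iota> ^ 2 * to_ac y ^ 2"
      by (simp add: algebra_simps power2_eq_square)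
    finally show ?thesis by (simp add: \<iota> Pair)
  qed
  have e_eq_0: "e A = 0 \<longleftrightarrow> A = 0" for A
  proof
    assume 0: "e A = 0"
    obtain x y where A: "A = (x, y)" by (cases A)
    have 1: "to_ac x - \<iota> * to_ac y = 0" using e_power_q[of x y] 0 A by (simp add: power_0_left)
    have 2: "to_ac x + \<iota> * to_ac y = 0" using 0 by (simp add: A e_def)
    have "2 * to_ac x = 0" using 1 2 by (simp add: algebra_simps)
    hence "x = 0" using two by (metis to_ac_eq_0_iff mult_eq_0_iff to_ac_numeral)
    moreover have "\<iota> \<noteq> 0" using \<iota> by auto
    ultimately show "A = 0" using 2 A by (simp add: zero_prod_def)
  qed (simp add: e_def zero_prod_def)
  have inj_e: "inj e" using e_eq_0 e_diff by (metis injI right_minus_eq)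
  \<comment> \<open>This is (q^2 - 1) / 2, so \<open>e A ^ m\<close> is the \<open>h\<close>-th
    power of the norm.\<close>
  define m where "m = h * (?q + 1)"
  have card: "card (range e) = 2 * m + 1"
    using inj_e by (simp add: card_image m_def qh algebra_simps)
  have e_power_m: "e A ^ m = to_ac (plane_norm A ^ h)" for A
    by (simp only: m_def mult.commute[of h] power_mult e_norm to_ac_power)
  have norm_eq_0: "plane_norm A = 0 \<longleftrightarrow> A = 0" for A :: "'a \<times> 'a"
    by (metis e_norm e_eq_0 power_eq_0_iff to_ac_eq_0_iff zero_less_Suc Suc_eq_plus1)
  \<comment> \<open>Distinct points have a difference of nonzero norm, so the \<open>h\<close>-th
    power is a sign that records exactly whether they are at integral distance.\<close>
  have norm_power: "plane_norm (\<phi> A - \<phi> B) ^ h = plane_norm (A - B) ^ h" for A B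
  proof (cases "A = B")
    case False
    hence "\<phi> A \<noteq> \<phi> B" using inj by (simp add: inj_eq)
    with False integral_automorphism_iff[OF \<phi>, of A B] show ?thesis
      by (simp add: euler_criterion[OF qh] norm_eq_0 integral_distance_def)
  qed simp
  interpret finite_subfield "range e"
  proof
    show "0 \<in> range e" using e_eq_0 by (metis rangeI)
    have "1 = e (1, 0)" by (simp add: e_def)
    thus "1 \<in> range e" by blast
    fix x y assume "x \<in> range e" "y \<in> range e"
    then obtain a b c d where xy: "x = e (a, b)" "y = e (c, d)" by auto
    have "x + y = e (a + c, b + d)" by (simp add: xy e_def algebra_simps)
    thus "x + y \<in> range e" by blast
    have "x * y = to_ac (a * c) + \<iota> ^ 2 * to_ac (b * d) + \<iota> * to_ac (a * d + b * c)"
      by (simp add: xy e_def algebra_simps power2_eq_square)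
    hence "x * y = e (a * c - b * d, a * d + b * c)"
      by (simp add: \<iota> e_def)
    thus "x * y \<in> range e" by blast
  qed simp
  \<comment> \<open>\<phi> transported to the field, with the base points \<open>P\<close> and
    \<open>\<phi> P\<close> both moved to 0.\<close>
  define f where "f z = e (\<phi> (P + inv_into UNIV e z) - \<phi> P)" for z
  have f_e: "f (e A) = e (\<phi> (P + A) - \<phi> P)" for A
    by (simp add: f_def inv_f_f[OF inj_e])
  have "f 0 = e 0" using f_e[of 0] e_eq_0[of 0] by simp
  hence f_0: "f 0 = 0" using e_eq_0 by simp
  obtain c d where cd: "\<And>x. x \<in> range e \<Longrightarrow> f x = c * x ^ d"
  proof (rule paley_automorphism_monomial[of m f])
    show "card (range e) = 2 * m + 1" "f 0 = 0" by (fact card f_0)+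
    show "f x \<in> range e" for x by (simp add: f_def)
    show "inj_on f (range e)"
      by (intro inj_onI) (auto simp: f_e inj_eq[OF inj_e] inj_eq[OF inj])
    fix x y assume "x \<in> range e" "y \<in> range e"
    then obtain A B where xy: "x = e A" "y = e B" by blast
    have "f x - f y = e (\<phi> (P + A) - \<phi> (P + B))" by (simp add: xy f_e flip: e_diff)
    hence "(f x - f y) ^ m = to_ac (plane_norm (\<phi> (P + A) - \<phi> (P + B)) ^ h)"
      by (simp add: e_power_m)
    also have "\<dots> = to_ac (plane_norm (P + A - (P + B)) ^ h)"
      by (simp only: norm_power)
    also have "\<dots> = (x - y) ^ m" by (simp only: xy e_power_m add_diff_cancel_left flip: e_diff)
    finally show "(f x - f y) ^ m = (x - y) ^ m" .
  qed blast
  \<comment> \<open>The map \<open>f\<close> is a monomial and powers of \<open>t\<close> stay in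
    the base field, so the image direction is \<open>\<phi> (P + V) - \<phi> P\<close>, with
    \<open>s = t ^ d\<close>.\<close>
  show "\<exists>V'. \<forall>t. \<exists>s. \<phi> (P + scale t V) = \<phi> P + scale s V'"
  proof (intro exI allI)
    fix t
    have "e (\<phi> (P + scale t V) - \<phi> P) = to_ac (t ^ d) * (c * e V ^ d)"
      using cd[OF rangeI, of "scale t V"] f_e[of "scale t V"]
      by (simp add: e_scale[of t V] power_mult_distrib mult_ac)
    also have "c * e V ^ d = e (\<phi> (P + V) - \<phi> P)"
      using cd[OF rangeI, of V] by (simp add: f_e)
    finally have "\<phi> (P + scale t V) - \<phi> P = scale (t ^ d) (\<phi> (P + V) - \<phi> P)"
      by (simp only: inj_eq[OF inj_e] flip: e_scale)
    thus "\<phi> (P + scale t V) = \<phi> P + scale (t ^ d) (\<phi> (P + V) - \<phi> P)"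
      by (simp add: algebra_simps)
  qed
qed

subsection \<open>Prime fields of order congruent to 1 modulo 4\<close>

text \<open>Even \<open>h\<close> encodes order 1 modulo 4; \<open>h > 2\<close> excludes order 5,
  so that 3 and 5 are nonzero in the field.\<close>

locale prime_field =
  fixes h :: nat and field_type :: "'a::{field,finite} itself"
  assumes card_UNIV: "CARD('a) = 2 * h + 1"
    and prime_card: "prime (2 * h + 1)"
    and even_h: "even h"
    and h_gt_2: "h > 2"
begin

sublocale finite_subfield "UNIV :: 'a set" by (rule finite_subfield_UNIV)

section \<open>Arithmetic in the prime field\<close>

lemma of_nat_eq_0_imp_dvd:
  assumes "of_nat n = (0::'a)"
  shows "2 * h + 1 dvd n"
proof -
  have "CHAR('a) dvd n" using assms by (simp add: of_nat_eq_0_iff_char_dvd)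
  moreover have "CHAR('a) dvd 2 * h + 1"
    using of_nat_card_eq_0 card_UNIV by (simp only: of_nat_eq_0_iff_char_dvd)
  moreover have "CHAR('a) \<noteq> 1"
    using of_nat_CHAR[where 'a = 'a] by (metis of_nat_1 one_neq_zero)
  ultimately show ?thesis using prime_card by (metis prime_nat_iff)
qed

lemma of_nat_neq_0:
  assumes "0 < n" "n < 2 * h + 1"
  shows "of_nat n \<noteq> (0::'a)"
  using of_nat_eq_0_imp_dvd[of n] nat_dvd_not_less[of n "2 * h + 1"] assms by blast

lemma two_h: "2 * of_nat h = (- 1 :: 'a)"
proof -
  have "of_nat (2 * h + 1) = (0::'a)" using of_nat_card_eq_0 card_UNIV by simp
  thus ?thesis by (simp add: eq_neg_iff_add_eq_0 add.commute)
qed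

text \<open>The coefficient of \<open>a ^ e * x ^ (h - e)\<close> in \<open>(a - x) ^ h\<close>; its
  sign \<open>(-1) ^ (h - e)\<close> equals \<open>(-1) ^ e\<close> because \<open>h\<close> is
  even.\<close>

definition sbinom :: "nat \<Rightarrow> 'a" where
  "sbinom e = (-1) ^ e * of_nat (h choose e)"

lemma sbinom_0 [simp]: "sbinom 0 = 1"
  and sbinom_h [simp]: "sbinom h = 1"
  using even_h by (simp_all add: sbinom_def)

lemma sbinom_1: "sbinom 1 = - of_nat h"
  and sbinom_h_minus_1: "sbinom (h - 1) = - of_nat h"
  using even_h h_gt_2 by (simp_all add: sbinom_def) (cases h; simp)

lemma sbinom_neq_0:
  assumes "e \<le> h"
  shows "sbinom e \<noteq> 0"
proof -
  have "\<not> 2 * h + 1 dvd h choose e"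
  proof
    assume "2 * h + 1 dvd h choose e"
    hence "2 * h + 1 dvd fact h"
      using binomial_fact_lemma[OF assms] by (metis dvd_mult)
    thus False using prime_card by (simp add: prime_dvd_fact_iff)
  qed
  hence "of_nat (h choose e) \<noteq> (0::'a)" using of_nat_eq_0_imp_dvd by blast
  thus ?thesis by (simp add: sbinom_def)
qed

text \<open>Fermat's little theorem. Positivity of \<open>k\<close> matters at \<open>x = 0\<close>,
  where \<open>x ^ (2 * h)\<close> is 0 but \<open>x ^ 0\<close> is 1.\<close>

lemma power_reduce: "k > 0 \<Longrightarrow> x ^ (2 * h + k) = (x ^ k :: 'a)"
proof -
  assume "k > 0"
  then obtain j where "k = Suc j" by (cases k) auto
  hence "x ^ (2 * h + k) = x ^ (2 * h + 1) * x ^ j" by (simp add: power_add)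
  also have "x ^ (2 * h + 1) = x" using power_card[of x] card_UNIV by simp
  finally show ?thesis using \<open>k = Suc j\<close> by simp
qed

lemma sum_power_less [simp]: "k < 2 * h \<Longrightarrow> (\<Sum>x\<in>UNIV. x ^ k :: 'a) = 0"
  using sum_power[of k] card_UNIV by (auto dest: dvd_imp_le)

lemma sum_power_2h [simp]: "(\<Sum>x\<in>UNIV. x ^ (2 * h) :: 'a) = - 1"
  using sum_power[of "2 * h"] card_UNIV h_gt_2 by simp

lemma sum_power_2h_plus_1 [simp]: "(\<Sum>x\<in>UNIV. x ^ (2 * h + 1) :: 'a) = 0"
  unfolding power_reduce[OF zero_less_one] using sum_power_less[of 1] h_gt_2 by simp

lemma conv_power_less: "i < h \<Longrightarrow> (\<Sum>x\<in>UNIV. (a - x) ^ h * x ^ i) = (0 :: 'a)"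
  using sum_diff_power_mult_power_eq_0[of i h a] card_UNIV by simp

text \<open>Convolution with the quadratic character lowers the degree by \<open>h\<close>; even
  \<open>h\<close> turns the sign into that of \<open>sbinom\<close>.\<close>

lemma conv_power_ge:
  assumes "e \<le> h"
  shows "(\<Sum>x\<in>UNIV. (a - x) ^ h * x ^ (h + e)) = (- sbinom e * a ^ e :: 'a)"
proof -
  have "(-1) ^ (h - e) = ((-1) ^ e :: 'a)"
    using even_h assms by (cases "even e") simp_all
  moreover have "2 * h - (h + e) = h - e" by simp
  ultimately show ?thesis
    using sum_diff_power_mult_power[of h "h + e" a] assms card_UNIV by (simp add: sbinom_def)
qed

section \<open>The kernel operator and its symmetries\<close>

definition kern :: "'a \<times> 'a \<Rightarrow> 'a \<times> 'a \<Rightarrow> 'a" where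
  "kern P Q = ((fst P - fst Q) * (snd P - snd Q)) ^ h
    + (if fst P = fst Q then 1 else 0) + (if snd P = snd Q then 1 else 0)"

definition kern_op :: "('a \<times> 'a \<Rightarrow> 'a) \<Rightarrow> 'a \<times> 'a \<Rightarrow> 'a" where
  "kern_op g P = (\<Sum>Q\<in>UNIV. kern P Q * g Q)"

definition monomial :: "nat \<Rightarrow> nat \<Rightarrow> 'a \<times> 'a \<Rightarrow> 'a" where
  "monomial i j P = fst P ^ i * snd P ^ j"

lemma kern_commute: "kern P Q = kern Q P"
proof -
  have "(fst P - fst Q) * (snd P - snd Q) = (fst Q - fst P) * (snd Q - snd P)"
    by (simp add: algebra_simps)
  thus ?thesis by (simp add: kern_def eq_commute)
qed

lemma kern_swap: "kern (prod.swap P) (prod.swap Q) = kern P Q"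
  by (simp add: kern_def mult.commute add.commute add.left_commute)

lemma sum_swap: "(\<Sum>P\<in>UNIV. F (prod.swap P)) = (\<Sum>P\<in>UNIV. F P :: 'a)"
  for F :: "'a \<times> 'a \<Rightarrow> 'a"
  by (rule sum.reindex_bij_witness[of _ prod.swap prod.swap]) auto

lemma kern_op_swap: "kern_op (g \<circ> prod.swap) P = kern_op g (prod.swap P)"
  unfolding kern_op_def
  by (subst sum_swap[symmetric]) (simp add: kern_swap flip: kern_swap[of _ "prod.swap _"])

lemma kern_op_add: "kern_op (\<lambda>P. f P + g P) P = kern_op f P + kern_op g P"
  by (simp add: kern_op_def algebra_simps sum.distrib)

lemma kern_op_mult: "kern_op (\<lambda>P. a * g P) P = a * kern_op g P"
  by (simp add: kern_op_def algebra_simps sum_distrib_left)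

text \<open>A symmetric kernel gives a self-adjoint operator. Hence functions in its range are
  orthogonal to its null space.\<close>

lemma sum_kern_op_commute: "(\<Sum>P\<in>UNIV. kern_op f P * g P) = (\<Sum>P\<in>UNIV. f P * kern_op g P)"
proof -
  have "(\<Sum>P\<in>UNIV. kern_op f P * g P) = (\<Sum>P\<in>UNIV. \<Sum>Q\<in>UNIV. kern P Q * f Q * g P)"
    by (simp add: kern_op_def sum_distrib_right)
  also have "\<dots> = (\<Sum>Q\<in>UNIV. \<Sum>P\<in>UNIV. kern P Q * f Q * g P)" by (rule sum.swap)
  also have "\<dots> = (\<Sum>P\<in>UNIV. f P * kern_op g P)"
    unfolding kern_op_def sum_distrib_left
    by (intro sum.cong refl) (simp add: kern_commute[of _ "_ :: 'a \<times> 'a"] mult_ac)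
  finally show ?thesis .
qed

lemma sum_fst_snd:
  "(\<Sum>P\<in>UNIV. f (fst P) * g (snd P)) = (\<Sum>x\<in>UNIV. f x) * (\<Sum>y\<in>UNIV. g y :: 'a)"
  for f g :: "'a \<Rightarrow> 'a"
  unfolding sum_product sum.cartesian_product UNIV_Times_UNIV by (simp add: case_prod_beta)

section \<open>The kernel operator on monomials\<close>

lemma sum_monomial: "(\<Sum>P\<in>UNIV. monomial i j P) = (\<Sum>x\<in>UNIV. x ^ i) * (\<Sum>y\<in>UNIV. y ^ j)"
  unfolding monomial_def by (rule sum_fst_snd)

text \<open>The \<open>h\<close>-th power in the kernel splits into two one-variable convolutions;
  each indicator restricts the sum to a coordinate line through \<open>(a, b)\<close>.\<close>

lemma kern_op_monomial:
  "kern_op (monomial i j) (a, b) =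
     (\<Sum>x\<in>UNIV. (a - x) ^ h * x ^ i) * (\<Sum>y\<in>UNIV. (b - y) ^ h * y ^ j)
     + a ^ i * (\<Sum>y\<in>UNIV. y ^ j) + b ^ j * (\<Sum>x\<in>UNIV. x ^ i)"
proof -
  have "kern_op (monomial i j) (a, b) =
      (\<Sum>P\<in>UNIV. ((a - fst P) ^ h * fst P ^ i) * ((b - snd P) ^ h * snd P ^ j))
      + (\<Sum>P\<in>UNIV. (if fst P = a then a ^ i else 0) * snd P ^ j)
      + (\<Sum>P\<in>UNIV. fst P ^ i * (if snd P = b then b ^ j else 0))"
    unfolding kern_op_def sum.distrib[symmetric]
    using h_gt_2 by (intro sum.cong refl)
      (auto simp: kern_def monomial_def power_mult_distrib distrib_right mult_ac power_0_left)
  also have "\<dots> = (\<Sum>x\<in>UNIV. (a - x) ^ h * x ^ i) * (\<Sum>y\<in>UNIV. (b - y) ^ h * y ^ j)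
     + a ^ i * (\<Sum>y\<in>UNIV. y ^ j) + b ^ j * (\<Sum>x\<in>UNIV. x ^ i)"
    unfolding sum_fst_snd[of "\<lambda>x. (a - x) ^ h * x ^ i" "\<lambda>y. (b - y) ^ h * y ^ j"]
      sum_fst_snd[of "\<lambda>x. if x = a then a ^ i else 0" "\<lambda>y. y ^ j"]
      sum_fst_snd[of "\<lambda>x. x ^ i" "\<lambda>y. if y = b then b ^ j else 0"]
    by simp
  finally show ?thesis .
qed

lemma kern_op_monomial_eq_0:
  assumes "i < h" "j < 2 * h"
  shows "kern_op (monomial i j) P = 0"
  using assms by (cases P) (simp add: kern_op_monomial conv_power_less)

lemma kern_op_monomial_2h:
  assumes "i < h"
  shows "kern_op (monomial i (2 * h)) P = - (fst P ^ i)"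
  using assms by (cases P) (simp add: kern_op_monomial conv_power_less)

lemma kern_op_monomial_ge:
  assumes "i < h" "j < h"
  shows "kern_op (monomial (h + i) (h + j)) P = sbinom i * sbinom j * monomial i j P"
  using assms by (cases P) (simp add: kern_op_monomial conv_power_ge monomial_def)

lemma kern_op_monomial_ge_2h:
  assumes "i < h"
  shows "kern_op (monomial (h + i) (2 * h)) P = sbinom i * fst P ^ i * snd P ^ h - fst P ^ (h + i)"
  using assms conv_power_ge[of h "snd P"]
  by (cases P) (simp add: kern_op_monomial conv_power_ge flip: mult_2)

section \<open>The test space \<open>W\<close> and its radical\<close>

definition W :: "('a \<times> 'a \<Rightarrow> 'a) set" where
  "W = {kern_op g | g. (\<Sum>P\<in>UNIV. g P) = 0}"

lemma W_swap:
  assumes "w \<in> W"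
  shows "w \<circ> prod.swap \<in> W"
proof -
  obtain g where g: "w = kern_op g" "(\<Sum>P\<in>UNIV. g P) = 0" using assms by (auto simp: W_def)
  have "w \<circ> prod.swap = kern_op (g \<circ> prod.swap)" by (auto simp: g kern_op_swap)
  moreover have "(\<Sum>P\<in>UNIV. (g \<circ> prod.swap) P) = 0" using g sum_swap[of g] by simp
  ultimately show ?thesis unfolding W_def by blast
qed

lemma monomial_in_W:
  assumes "i < h" "j < h"
  shows "monomial i j \<in> W"
proof -
  define a where "a = inverse (sbinom i * sbinom j)"
  have "sbinom i * sbinom j \<noteq> 0" using sbinom_neq_0[of i] sbinom_neq_0[of j] assms by simp
  hence "a * (sbinom i * sbinom j) = 1" unfolding a_def by (rule left_inverse)
  hence "monomial i j = kern_op (\<lambda>P. a * monomial (h + i) (h + j) P)"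
    by (intro ext) (simp add: kern_op_mult kern_op_monomial_ge[OF assms] flip: mult.assoc)
  moreover have "(\<Sum>P\<in>UNIV. a * monomial (h + i) (h + j) P) = 0"
    using assms by (simp add: sum_monomial flip: sum_distrib_left)
  ultimately show ?thesis unfolding W_def by blast
qed

text \<open>For \<open>e < h\<close> this is the image of \<open>monomial (h + e) (2 * h)\<close>.
  It brings exponents of \<open>h\<close> and more into \<open>W\<close>, beyond those of
  \<open>monomial_in_W\<close>.\<close>

definition mixed :: "nat \<Rightarrow> 'a \<times> 'a \<Rightarrow> 'a" where
  "mixed e P = sbinom e * fst P ^ e * snd P ^ h - fst P ^ (h + e)"

lemma mixed_in_W:
  assumes "e < h"
  shows "mixed e \<in> W"
proof -
  have "mixed e = kern_op (monomial (h + e) (2 * h))"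
    by (intro ext) (simp add: kern_op_monomial_ge_2h[OF assms] mixed_def)
  moreover have "(\<Sum>P\<in>UNIV. monomial (h + e) (2 * h) P) = 0"
    using assms by (simp add: sum_monomial)
  ultimately show ?thesis unfolding W_def by blast
qed

definition radical :: "('a \<times> 'a \<Rightarrow> 'a) set" where
  "radical = {f. f \<in> range kern_op \<and> (\<forall>w1\<in>W. \<forall>w2\<in>W. (\<Sum>P\<in>UNIV. f P * (w1 P * w2 P)) = 0)}"

lemma radicalI:
  assumes "f = kern_op g" "\<And>w1 w2. w1 \<in> W \<Longrightarrow> w2 \<in> W \<Longrightarrow> (\<Sum>P\<in>UNIV. f P * (w1 P * w2 P)) = 0"
  shows "f \<in> radical"
  using assms(2) unfolding radical_def by (auto simp: assms(1))

lemma radicalD: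
  assumes "f \<in> radical" "w1 \<in> W" "w2 \<in> W"
  shows "(\<Sum>P\<in>UNIV. f P * (w1 P * w2 P)) = 0"
  using assms by (simp add: radical_def)

lemma radical_swap:
  assumes "f \<in> radical"
  shows "f \<circ> prod.swap \<in> radical"
proof -
  obtain g where "f = kern_op g" using assms by (auto simp: radical_def)
  hence "f \<circ> prod.swap = kern_op (g \<circ> prod.swap)" by (auto simp: kern_op_swap)
  moreover have "(\<Sum>P\<in>UNIV. (f \<circ> prod.swap) P * (w1 P * w2 P)) = 0" if "w1 \<in> W" "w2 \<in> W" for w1 w2
  proof -
    have "(\<Sum>P\<in>UNIV. (f \<circ> prod.swap) P * (w1 P * w2 P))
        = (\<Sum>P\<in>UNIV. f P * ((w1 \<circ> prod.swap) P * (w2 \<circ> prod.swap) P))"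
      by (subst sum_swap[symmetric]) simp
    thus ?thesis using radicalD[OF assms W_swap[OF that(1)] W_swap[OF that(2)]] by simp
  qed
  ultimately show ?thesis by (rule radicalI)
qed

lemma radical_add:
  assumes "f \<in> radical" "g \<in> radical"
  shows "(\<lambda>P. f P + a * g P) \<in> radical"
proof -
  obtain f' g' where "f = kern_op f'" "g = kern_op g'" using assms by (auto simp: radical_def)
  hence "(\<lambda>P. f P + a * g P) = kern_op (\<lambda>P. f' P + a * g' P)"
    by (intro ext) (simp add: kern_op_add kern_op_mult)
  moreover have "(\<Sum>P\<in>UNIV. (f P + a * g P) * (w1 P * w2 P)) = 0" if "w1 \<in> W" "w2 \<in> W" for w1 w2
  proof -
    have "(\<Sum>P\<in>UNIV. (f P + a * g P) * (w1 P * w2 P))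
        = (\<Sum>P\<in>UNIV. f P * (w1 P * w2 P)) + a * (\<Sum>P\<in>UNIV. g P * (w1 P * w2 P))"
      by (simp add: sum_distrib_left algebra_simps sum.distrib)
    thus ?thesis using radicalD[OF assms(1) that] radicalD[OF assms(2) that] by simp
  qed
  ultimately show ?thesis by (rule radicalI)
qed

text \<open>Invariance of \<open>kern\<close> makes \<open>kern_op\<close> commute with composition
  by \<phi>, and bijectivity leaves total sums unchanged. So the range, \<open>W\<close> and the
  pairing are all preserved.\<close>

lemma radical_comp:
  assumes f: "f \<in> radical" and bij: "bij \<phi>" and kern: "\<And>P Q. kern (\<phi> P) (\<phi> Q) = kern P Q"
  shows "f \<circ> \<phi> \<in> radical"
proof -
  have op_comp: "kern_op (g \<circ> \<phi>) = kern_op g \<circ> \<phi>" for g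
  proof
    fix P
    have "kern_op (g \<circ> \<phi>) P = (\<Sum>Q\<in>UNIV. kern (\<phi> P) (\<phi> Q) * g (\<phi> Q))" by (simp add: kern_op_def kern)
    also have "\<dots> = kern_op g (\<phi> P)" unfolding kern_op_def by (rule sum.reindex_bij_betw[OF bij])
    finally show "kern_op (g \<circ> \<phi>) P = (kern_op g \<circ> \<phi>) P" by simp
  qed
  have comp_image: "\<exists>w'\<in>W. w = w' \<circ> \<phi>" if "w \<in> W" for w
  proof -
    obtain g where g: "w = kern_op g" "(\<Sum>P\<in>UNIV. g P) = 0" using \<open>w \<in> W\<close> by (auto simp: W_def)
    define g' where "g' = g \<circ> inv_into UNIV \<phi>"
    have "g = g' \<circ> \<phi>" using bij by (auto simp: g'_def bij_def)
    moreover from this have "(\<Sum>P\<in>UNIV. g' P) = 0"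
      using g sum.reindex_bij_betw[OF bij, of g'] by simp
    ultimately show ?thesis using g op_comp[of g'] by (auto simp: W_def)
  qed
  obtain g where "f = kern_op g" using f by (auto simp: radical_def)
  hence "f \<circ> \<phi> = kern_op (g \<circ> \<phi>)" by (simp add: op_comp)
  moreover have "(\<Sum>P\<in>UNIV. (f \<circ> \<phi>) P * (w1 P * w2 P)) = 0" if w: "w1 \<in> W" "w2 \<in> W" for w1 w2
  proof -
    from comp_image w obtain w1' w2' where w': "w1' \<in> W" "w2' \<in> W" "w1 = w1' \<circ> \<phi>" "w2 = w2' \<circ> \<phi>"
      by blast
    have "(\<Sum>P\<in>UNIV. (f \<circ> \<phi>) P * (w1 P * w2 P)) = (\<Sum>P\<in>UNIV. f P * (w1' P * w2' P))"
      using sum.reindex_bij_betw[OF bij, of "\<lambda>P. f P * (w1' P * w2' P)"] by (simp add: w')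
    thus ?thesis using radicalD[OF f w'(1,2)] by simp
  qed
  ultimately show ?thesis by (rule radicalI)
qed

section \<open>Affine functions lie in the radical\<close>

lemma conv_conv:
  assumes "k \<le> 1"
  shows "(\<Sum>r\<in>UNIV. r ^ k * (a - r) ^ h * (b - r) ^ h)
    = (if k = 0 then - 1 else of_nat h * (a + b) :: 'a)"
proof -
  have "r ^ k * (a - r) ^ h * (b - r) ^ h
      = (\<Sum>i\<le>h. sbinom i * a ^ i * ((b - r) ^ h * r ^ (h - i + k)))" for r
  proof -
    have "(a - r) ^ h = (\<Sum>i\<le>h. of_nat (h choose i) * a ^ i * (- r) ^ (h - i))"
      unfolding diff_conv_add_uminus by (rule binomial_ring)
    also have "\<dots> = (\<Sum>i\<le>h. sbinom i * a ^ i * r ^ (h - i))"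
    proof (intro sum.cong refl)
      fix i assume "i \<in> {..h}"
      hence "(- r) ^ (h - i) = (-1) ^ i * r ^ (h - i)"
        using even_h by (cases "even i") (simp_all add: power_minus_even power_minus_odd)
      thus "of_nat (h choose i) * a ^ i * (- r) ^ (h - i) = sbinom i * a ^ i * r ^ (h - i)"
        by (simp add: sbinom_def mult_ac)
    qed
    finally show ?thesis
      by (simp only: sum_distrib_left sum_distrib_right power_add mult_ac)
  qed
  hence "(\<Sum>r\<in>UNIV. r ^ k * (a - r) ^ h * (b - r) ^ h)
      = (\<Sum>i\<le>h. sbinom i * a ^ i * (\<Sum>r\<in>UNIV. (b - r) ^ h * r ^ (h - i + k)))"
    by (simp only: sum_distrib_left) (rule sum.swap)
  \<comment> \<open>For \<open>i > k\<close> the exponent \<open>h - i + k\<close> is below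
    \<open>h\<close> and the convolution vanishes, so at most two terms survive.\<close>
  also have "\<dots> = (\<Sum>i\<le>k. sbinom i * a ^ i * (\<Sum>r\<in>UNIV. (b - r) ^ h * r ^ (h + (k - i))))"
  proof (rule sum.mono_neutral_cong_right)
    show "\<forall>i\<in>{..h} - {..k}. sbinom i * a ^ i * (\<Sum>r\<in>UNIV. (b - r) ^ h * r ^ (h - i + k)) = 0"
      by (intro ballI) (subst conv_power_less, auto)
    fix i assume "i \<in> {..k}"
    moreover from this have "h - i + k = h + (k - i)" using assms h_gt_2 by auto
    ultimately show "sbinom i * a ^ i * (\<Sum>r\<in>UNIV. (b - r) ^ h * r ^ (h - i + k))
        = sbinom i * a ^ i * (\<Sum>r\<in>UNIV. (b - r) ^ h * r ^ (h + (k - i)))" by simp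
  qed (use assms h_gt_2 in auto)
  also have "\<dots> = (\<Sum>i\<le>k. sbinom i * a ^ i * (- sbinom (k - i) * b ^ (k - i)))"
  proof (intro sum.cong refl)
    fix i
    have "k - i \<le> h" using assms h_gt_2 by simp
    thus "sbinom i * a ^ i * (\<Sum>r\<in>UNIV. (b - r) ^ h * r ^ (h + (k - i)))
        = sbinom i * a ^ i * (- sbinom (k - i) * b ^ (k - i))" by (simp only: conv_power_ge)
  qed
  also have "\<dots> = (if k = 0 then - 1 else of_nat h * (a + b))"
  proof (cases "k = 0")
    case False
    with assms have "k = 1" by simp
    thus ?thesis using sbinom_1 by (simp add: algebra_simps)
  qed simp
  finally show ?thesis .
qed

text \<open>The point is the separated form: a function of \<open>P\<close> plus a function of
  \<open>Q\<close> vanishes when summed against two functions of total sum zero.\<close>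

lemma sum_kern_kern:
  assumes "k \<le> 1"
  shows "\<exists>\<alpha> \<beta>. \<forall>P Q. (\<Sum>R\<in>UNIV. fst R ^ k * (kern P R * kern Q R)) = \<alpha> P + (\<beta> Q :: 'a)"
proof -
  define A where "A a r = (a - r) ^ h" for a r :: 'a
  define D where "D a r = (if a = r then 1 else 0 :: 'a)" for a r :: 'a
  have D_sum: "(\<Sum>r\<in>UNIV. f r * D a r) = f a" for f :: "'a \<Rightarrow> 'a" and a
    by (simp add: D_def if_distrib cong: if_cong)
  have A_sum: "(\<Sum>r\<in>UNIV. r ^ k * A a r) = 0" "(\<Sum>r\<in>UNIV. A a r) = 0" for a
    using conv_power_less[of k a] conv_power_less[of 0 a] assms h_gt_2
    by (simp_all add: A_def mult.commute)
  have "\<forall>P Q. (\<Sum>R\<in>UNIV. fst R ^ k * (kern P R * kern Q R)) =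
      ((if k = 0 then 1 else - of_nat h * fst P) + fst P ^ k)
      + ((if k = 0 then 0 else - of_nat h * fst Q) + fst Q ^ k)"
  proof (intro allI)
    fix P Q :: "'a \<times> 'a"
    obtain p p' q q' where PQ: "P = (p, p')" "Q = (q, q')" by (metis surj_pair)
    have k: "kern P R = A p (fst R) * A p' (snd R) + D p (fst R) + D p' (snd R)"
      "kern Q R = A q (fst R) * A q' (snd R) + D q (fst R) + D q' (snd R)" for R
      by (simp_all add: PQ kern_def A_def D_def power_mult_distrib)
    have "(\<Sum>R\<in>UNIV. fst R ^ k * (kern P R * kern Q R)) =
        (\<Sum>R\<in>UNIV. (fst R ^ k * A p (fst R) * A q (fst R)) * (A p' (snd R) * A q' (snd R)))
      + (\<Sum>R\<in>UNIV. (fst R ^ k * A p (fst R) * D q (fst R)) * A p' (snd R))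
      + (\<Sum>R\<in>UNIV. (fst R ^ k * A p (fst R)) * (A p' (snd R) * D q' (snd R)))
      + (\<Sum>R\<in>UNIV. (fst R ^ k * D p (fst R) * A q (fst R)) * A q' (snd R))
      + (\<Sum>R\<in>(UNIV :: ('a \<times> 'a) set). (fst R ^ k * D p (fst R) * D q (fst R)) * 1)
      + (\<Sum>R\<in>UNIV. (fst R ^ k * D p (fst R)) * (1 * D q' (snd R)))
      + (\<Sum>R\<in>UNIV. (fst R ^ k * A q (fst R)) * (D p' (snd R) * A q' (snd R)))
      + (\<Sum>R\<in>UNIV. (fst R ^ k * D q (fst R)) * (1 * D p' (snd R)))
      + (\<Sum>R\<in>UNIV. (fst R ^ k) * (D p' (snd R) * D q' (snd R)))"
      unfolding sum.distrib[symmetric]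
      by (intro sum.cong refl) (simp only: k, Groebner_Basis.algebra)
    \<comment> \<open>Three of the nine sums survive: the one with four factors \<open>A\<close>,
      and the two with an indicator in each coordinate. Every other one contains a vanishing sum of
      \<open>A\<close> or a power sum of exponent at most 1.\<close>
    also have "\<dots> = (\<Sum>r\<in>UNIV. r ^ k * A p r * A q r) * (\<Sum>r\<in>UNIV. A p' r * A q' r) + p ^ k + q ^ k"
      unfolding sum_fst_snd[of "\<lambda>r. r ^ k * A p r * A q r" "\<lambda>r. A p' r * A q' r"]
        sum_fst_snd[of "\<lambda>r. r ^ k * A p r * D q r" "\<lambda>r. A p' r"]
        sum_fst_snd[of "\<lambda>r. r ^ k * A p r" "\<lambda>r. A p' r * D q' r"]
        sum_fst_snd[of "\<lambda>r. r ^ k * D p r * A q r" "\<lambda>r. A q' r"]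
        sum_fst_snd[of "\<lambda>r. r ^ k * D p r * D q r" "\<lambda>r. 1"]
        sum_fst_snd[of "\<lambda>r. r ^ k * D p r" "\<lambda>r. 1 * D q' r"]
        sum_fst_snd[of "\<lambda>r. r ^ k * A q r" "\<lambda>r. D p' r * A q' r"]
        sum_fst_snd[of "\<lambda>r. r ^ k * D q r" "\<lambda>r. 1 * D p' r"]
        sum_fst_snd[of "\<lambda>r. r ^ k" "\<lambda>r. D p' r * D q' r"]
      using assms h_gt_2 sum_power_less[of 0] sum_power_less[of k]
      by (simp only: A_sum D_sum) simp
    also have "(\<Sum>r\<in>UNIV. A p' r * A q' r) = - 1"
      using conv_conv[of 0 p' q'] by (simp add: A_def)
    also have "(\<Sum>r\<in>UNIV. r ^ k * A p r * A q r) = (if k = 0 then - 1 else of_nat h * (p + q))"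
      unfolding A_def using assms by (rule conv_conv)
    also have "(if k = 0 then - 1 else of_nat h * (p + q)) * - 1 + p ^ k + q ^ k =
      ((if k = 0 then 1 else - of_nat h * fst P) + fst P ^ k)
      + ((if k = 0 then 0 else - of_nat h * fst Q) + fst Q ^ k)"
      using assms by (cases "k = 0") (simp_all add: PQ algebra_simps)
    finally show "(\<Sum>R\<in>UNIV. fst R ^ k * (kern P R * kern Q R)) =
      ((if k = 0 then 1 else - of_nat h * fst P) + fst P ^ k)
      + ((if k = 0 then 0 else - of_nat h * fst Q) + fst Q ^ k)" .
  qed
  thus ?thesis
    by (intro exI[of _ "\<lambda>P. (if k = 0 then 1 else - of_nat h * fst P) + fst P ^ k"]
        exI[of _ "\<lambda>Q. (if k = 0 then 0 else - of_nat h * fst Q) + fst Q ^ k"])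
qed

text \<open>Insert \<open>w1 = kern_op g1\<close> and \<open>w2 = kern_op g2\<close> and sum over
  \<open>R\<close> first. Each separated term then carries the total sum of \<open>g1\<close> or of
  \<open>g2\<close>, which is 0 by the definition of \<open>W\<close>.\<close>

lemma fst_power_in_radical:
  assumes "k \<le> 1"
  shows "(\<lambda>P. fst P ^ k) \<in> radical"
proof -
  have k: "k < h" using assms h_gt_2 by simp
  have "(\<lambda>P. fst P ^ k) = monomial k 0" by (auto simp: monomial_def)
  with monomial_in_W[of k 0] k h_gt_2 obtain g where "(\<lambda>P. fst P ^ k) = kern_op g"
    by (auto simp: W_def)
  moreover have "(\<Sum>R\<in>UNIV. fst R ^ k * (w1 R * w2 R)) = 0" if w: "w1 \<in> W" "w2 \<in> W" for w1 w2
  proof -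
    obtain g1 where g1: "w1 = kern_op g1" "(\<Sum>P\<in>UNIV. g1 P) = 0" using w by (auto simp: W_def)
    obtain g2 where g2: "w2 = kern_op g2" "(\<Sum>P\<in>UNIV. g2 P) = 0" using w by (auto simp: W_def)
    obtain \<alpha> \<beta> where \<alpha>\<beta>: "(\<Sum>R\<in>UNIV. fst R ^ k * (kern P R * kern Q R)) = \<alpha> P + \<beta> Q" for P Q
      using sum_kern_kern[OF assms] by blast
    have "(\<Sum>R\<in>UNIV. fst R ^ k * (w1 R * w2 R))
        = (\<Sum>R\<in>UNIV. \<Sum>P\<in>UNIV. \<Sum>Q\<in>UNIV. g1 P * g2 Q * (fst R ^ k * (kern P R * kern Q R)))"
    proof (intro sum.cong refl)
      fix R
      have "w1 R * w2 R = (\<Sum>P\<in>UNIV. \<Sum>Q\<in>UNIV. kern P R * g1 P * (kern Q R * g2 Q))"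
        unfolding g1 g2 kern_op_def sum_product by (simp only: kern_commute[of R])
      thus "fst R ^ k * (w1 R * w2 R)
          = (\<Sum>P\<in>UNIV. \<Sum>Q\<in>UNIV. g1 P * g2 Q * (fst R ^ k * (kern P R * kern Q R)))"
        by (simp only: sum_distrib_left mult_ac)
    qed
    also have "\<dots> = (\<Sum>P\<in>UNIV. \<Sum>R\<in>UNIV. \<Sum>Q\<in>UNIV. g1 P * g2 Q * (fst R ^ k * (kern P R * kern Q R)))"
      by (rule sum.swap)
    also have "\<dots> = (\<Sum>P\<in>UNIV. \<Sum>Q\<in>UNIV. \<Sum>R\<in>UNIV. g1 P * g2 Q * (fst R ^ k * (kern P R * kern Q R)))"
      by (intro sum.cong refl sum.swap)
    also have "\<dots> = (\<Sum>P\<in>UNIV. \<Sum>Q\<in>UNIV. g1 P * g2 Q * (\<alpha> P + \<beta> Q))"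
      by (simp only: \<alpha>\<beta> flip: sum_distrib_left)
    also have "\<dots> = (\<Sum>P\<in>UNIV. g1 P * \<alpha> P) * (\<Sum>Q\<in>UNIV. g2 Q)
        + (\<Sum>P\<in>UNIV. g1 P) * (\<Sum>Q\<in>UNIV. g2 Q * \<beta> Q)"
      unfolding sum_product sum.distrib[symmetric] by (simp add: algebra_simps)
    finally show ?thesis using g1 g2 by simp
  qed
  ultimately show ?thesis by (rule radicalI)
qed

lemma one_in_radical: "(\<lambda>P. 1) \<in> radical"
  and fst_in_radical: "fst \<in> radical"
  and snd_in_radical: "snd \<in> radical"
proof -
  show "(\<lambda>P. 1) \<in> radical" using fst_power_in_radical[of 0] by simp
  show *: "fst \<in> radical" using fst_power_in_radical[of 1] by simp
  have "snd = fst \<circ> (prod.swap :: 'a \<times> 'a \<Rightarrow> _)" by auto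
  thus "snd \<in> radical" using radical_swap[OF *] by simp
qed

section \<open>Moments of functions in the radical\<close>

definition moment :: "('a \<times> 'a \<Rightarrow> 'a) \<Rightarrow> nat \<Rightarrow> nat \<Rightarrow> 'a" where
  "moment f i j = (\<Sum>P\<in>UNIV. f P * monomial i j P)"

lemma moment_swap: "moment (f \<circ> prod.swap) i j = moment f j i"
  unfolding moment_def by (subst sum_swap[symmetric]) (simp add: monomial_def mult.commute)

text \<open>An exponent up to \<open>2 * h - 2\<close> is a sum of two exponents below
  \<open>h\<close>, so the monomial is a product of two monomials in \<open>W\<close>.\<close>

lemma moment_eq_0_low:
  assumes "f \<in> radical" "i \<le> 2 * h - 2" "j \<le> 2 * h - 2"
  shows "moment f i j = 0"
proof -
  have split: "\<exists>a b. a < h \<and> b < h \<and> k = a + b" if "k \<le> 2 * h - 2" for k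
    using that h_gt_2
    by (intro exI[of _ "min k (h - 1)"] exI[of _ "k - min k (h - 1)"]) auto
  obtain a b where ab: "a < h" "b < h" "i = a + b" using split[OF assms(2)] by blast
  obtain c d where cd: "c < h" "d < h" "j = c + d" using split[OF assms(3)] by blast
  have "moment f i j = (\<Sum>P\<in>UNIV. f P * (monomial a c P * monomial b d P))"
    unfolding moment_def by (simp add: monomial_def ab cd power_add mult_ac)
  thus ?thesis using radicalD[OF assms(1) monomial_in_W monomial_in_W] ab cd by simp
qed

lemma moment_perp:
  assumes "f \<in> radical" "\<And>P. kern_op m P = 0"
  shows "(\<Sum>P\<in>UNIV. f P * m P) = 0"
proof -
  obtain g where "f = kern_op g" using assms by (auto simp: radical_def)
  thus ?thesis using sum_kern_op_commute[of g m] assms(2) by simp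
qed

lemma moment_less:
  assumes "f \<in> radical" "i < h" "j < 2 * h"
  shows "moment f i j = 0"
  unfolding moment_def using assms by (intro moment_perp kern_op_monomial_eq_0)

text \<open>The images of the two monomials under \<open>kern_op\<close> cancel, so this combination
  lies in the null space.\<close>

lemma moment_2h_relation:
  assumes "f \<in> radical" "i < h"
  shows "sbinom i * moment f i (2 * h) + moment f (h + i) h = 0"
proof -
  have h_pos: "0 < h" using h_gt_2 by simp
  have "kern_op (\<lambda>P. sbinom i * monomial i (2 * h) P + monomial (h + i) (h + 0) P) P = 0" for P
    unfolding kern_op_add kern_op_mult kern_op_monomial_2h[OF assms(2)]
      kern_op_monomial_ge[OF assms(2) h_pos]
    by (simp add: monomial_def)
  from moment_perp[OF assms(1) this] show ?thesis
    by (simp add: moment_def sum_distrib_left algebra_simps sum.distrib)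
qed

text \<open>Orthogonality to \<open>monomial a b\<close> times \<open>mixed e\<close>; it reaches
  the exponent \<open>2 * h - 1\<close> in the second coordinate.\<close>

lemma moment_monomial_mixed:
  assumes "f \<in> radical" "a < h" "b < h" "e < h"
  shows "sbinom e * moment f (a + e) (b + h) = moment f (a + h + e) b"
proof -
  have "0 = (\<Sum>P\<in>UNIV. f P * (monomial a b P * mixed e P))"
    using radicalD[OF assms(1) monomial_in_W mixed_in_W] assms by simp
  also have "\<dots> = sbinom e * moment f (a + e) (b + h) - moment f (a + h + e) b"
    unfolding moment_def sum_distrib_left sum_subtractf[symmetric]
    by (intro sum.cong refl) (simp add: monomial_def mixed_def power_add algebra_simps)
  finally show ?thesis by simp
qed

lemma power_2h: "x ^ (2 * h) = x ^ h * (x ^ h :: 'a)"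
  by (simp add: mult_2 power_add)

text \<open>Orthogonality to a product of two \<open>mixed\<close> functions; it reaches the
  exponent \<open>2 * h\<close> in the second coordinate.\<close>

lemma moment_mixed_mixed:
  assumes "f \<in> radical" "d < h" "e < h"
  shows "sbinom d * sbinom e * moment f (d + e) (2 * h)
      - (sbinom d + sbinom e) * moment f (h + d + e) h
    + moment f (2 * h + d + e) 0 = 0"
proof -
  have "0 = (\<Sum>P\<in>UNIV. f P * (mixed d P * mixed e P))"
    using radicalD[OF assms(1) mixed_in_W mixed_in_W] assms by simp
  also have "\<dots> = sbinom d * sbinom e * moment f (d + e) (2 * h)
      - (sbinom d + sbinom e) * moment f (h + d + e) h
      + moment f (2 * h + d + e) 0"
    unfolding moment_def sum_distrib_left sum_subtractf[symmetric] sum.distrib[symmetric]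
    by (intro sum.cong refl)
      (simp only: monomial_def mixed_def power_add power_2h o_apply fst_swap snd_swap,
       simp add: algebra_simps)
  finally show ?thesis by simp
qed

text \<open>Swapping one of the factors raises both exponents together, as needed for the pair
  \<open>2 * h - 1\<close>, \<open>2 * h - 1\<close>.\<close>

lemma moment_mixed_swap:
  assumes "f \<in> radical" "d < h" "e < h"
  shows "sbinom d * sbinom e * moment f (d + h) (h + e) - sbinom d * moment f d (2 * h + e)
    - sbinom e * moment f (2 * h + d) e + moment f (h + d) (h + e) = 0"
proof -
  have "0 = (\<Sum>P\<in>UNIV. f P * (mixed d P * (mixed e \<circ> prod.swap) P))"
    using radicalD[OF assms(1) mixed_in_W W_swap[OF mixed_in_W]] assms by simp
  also have "\<dots> = sbinom d * sbinom e * moment f (d + h) (h + e) - sbinom d * moment f d (2 * h + e)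
      - sbinom e * moment f (2 * h + d) e + moment f (h + d) (h + e)"
    unfolding moment_def sum_distrib_left sum_subtractf[symmetric] sum.distrib[symmetric]
    by (intro sum.cong refl)
      (simp only: monomial_def mixed_def power_add power_2h o_apply fst_swap snd_swap,
       simp add: algebra_simps)
  finally show ?thesis by simp
qed

section \<open>Vanishing of the remaining moments\<close>

lemma moment_reduce_fst: "k > 0 \<Longrightarrow> moment f (2 * h + k) j = moment f k j"
  and moment_reduce_snd: "k > 0 \<Longrightarrow> moment f i (2 * h + k) = moment f i k"
  by (simp_all add: moment_def monomial_def power_reduce)

text \<open>\<open>sbinom (h - 1)\<close> is \<open>- of_nat h\<close>, which is one half because
  \<open>2 * h + 1\<close> is 0 in the field.\<close>

lemma four_sbinom: "4 * (sbinom (h - 1) * sbinom (h - 1)) = 1"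
proof -
  have "4 * (sbinom (h - 1) * sbinom (h - 1)) = (2 * of_nat h) * (2 * of_nat h)"
    unfolding sbinom_h_minus_1 by simp
  thus ?thesis by (simp only: two_h) simp
qed

lemma three_neq_0: "(3::'a) \<noteq> 0" and five_neq_0: "(5::'a) \<noteq> 0"
  using of_nat_neq_0[of 3] of_nat_neq_0[of 5] h_gt_2 by simp_all

lemma moment_h_2h_minus_1:
  assumes "f \<in> radical"
  shows "sbinom (h - 1) * moment f h (2 * h - 1) = moment f (2 * h) (h - 1)"
  using moment_monomial_mixed[OF assms, of 1 "h - 1" "h - 1"] h_gt_2 by (simp add: mult_2)

lemma moment_2h_minus_1:
  assumes f: "f \<in> radical" and "i \<le> 2 * h - 2"
  shows "moment f i (2 * h - 1) = 0"
proof -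
  consider "i < h" | "i = h" | "h < i" by linarith
  thus ?thesis
  proof cases
    case 1
    thus ?thesis using moment_less[OF f] by simp
  next
    case 2
    \<comment> \<open>Combined with \<open>moment_h_2h_minus_1\<close>, this says that c^2 + 1
      annihilates the moment, where c = 1/2. After multiplying by 4 the factor is 5, nonzero in the
      field.\<close>
    have "sbinom (h - 1) * moment f (2 * h) (h - 1) + moment f h (2 * h - 1) = 0"
      using moment_2h_relation[OF radical_swap[OF f], of "h - 1"] h_gt_2
      by (simp add: moment_swap mult_2)
    hence "(sbinom (h - 1) * sbinom (h - 1) + 1) * moment f h (2 * h - 1) = 0"
      unfolding moment_h_2h_minus_1[OF f, symmetric] by (simp add: algebra_simps)
    hence "(4 * (sbinom (h - 1) * sbinom (h - 1)) + 4) * moment f h (2 * h - 1) = 0"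
      by Groebner_Basis.algebra
    thus ?thesis using five_neq_0 unfolding four_sbinom by (simp add: 2)
  next
    case 3
    \<comment> \<open>The choice of exponents pushes the first one past \<open>2 * h\<close>, where
      it reduces to \<open>i - h\<close> and the moment is a low one.\<close>
    have "sbinom (h - 1) * moment f i (2 * h - 1) = moment f (2 * h + (i - h)) (h - 1)"
    proof -
      have eqs: "i - h + 1 + (h - 1) = i" "h - 1 + h = 2 * h - 1"
        "i - h + 1 + h + (h - 1) = 2 * h + (i - h)"
        using 3 h_gt_2 by auto
      show ?thesis
        using moment_monomial_mixed[OF f, of "i - h + 1" "h - 1" "h - 1"] 3 assms(2)
        unfolding eqs by simp
    qed
    also have "\<dots> = 0"
    proof -
      have "i - h > 0" using 3 by simp
      thus ?thesis
        using assms(2) unfolding moment_reduce_fst[OF \<open>i - h > 0\<close>]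
        by (simp add: moment_eq_0_low[OF f])
    qed
    finally show ?thesis using sbinom_neq_0[of "h - 1"] by simp
  qed
qed

lemma moment_2h:
  assumes f: "f \<in> radical" and "i \<le> 2 * h - 2"
  shows "moment f i (2 * h) = 0"
proof -
  consider "i < h - 1" | "i = h - 1" | "i = h" | "h < i" by linarith
  thus ?thesis
  proof cases
    case 1
    hence "sbinom i * moment f i (2 * h) = 0"
      using moment_2h_relation[OF f, of i] moment_eq_0_low[OF f, of "h + i" h] h_gt_2 by simp
    thus ?thesis using sbinom_neq_0[of i] 1 by simp
  next
    case 2
    have "moment (f \<circ> prod.swap) (2 * h) (h - 1) = 0"
      using moment_h_2h_minus_1[OF radical_swap[OF f]]
        moment_2h_minus_1[OF radical_swap[OF f], of h] h_gt_2
      by simp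
    thus ?thesis by (simp add: moment_swap 2)
  next
    case 3
    define c where "c = sbinom (h - 1)"
    have c: "sbinom 1 = c" "sbinom (h - 1) = c"
      unfolding c_def by (simp_all only: sbinom_1 sbinom_h_minus_1)
    have c4: "4 * (c * c) = 1" unfolding c_def by (rule four_sbinom)
    \<comment> \<open>Applied to \<open>f\<close> and to its swap, this gives two relations between
      the same two moments. Eliminating one leaves M = 16 M, and 15 is nonzero in the field.\<close>
    have rel: "c * c * moment g h (2 * h) = 2 * c * moment g (2 * h) h" if g: "g \<in> radical" for g
    proof -
      have eqs: "h - 1 + 1 = h" "h + (h - 1) + 1 = 2 * h" "2 * h + (h - 1) + 1 = 2 * h + h"
        using h_gt_2 by auto
      have "c * c * moment g h (2 * h) - (c + c) * moment g (2 * h) h + moment g (2 * h + h) 0 = 0"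
        using moment_mixed_mixed[OF g, of "h - 1" 1] h_gt_2 unfolding eqs c by simp
      thus ?thesis
        using h_gt_2 moment_reduce_fst[of h g 0] moment_eq_0_low[OF g, of h 0] by simp
    qed
    have c_nz: "c \<noteq> 0" unfolding c_def using sbinom_neq_0 by simp
    have eq1: "c * moment f h (2 * h) = 2 * moment f (2 * h) h"
      using rel[OF f] c_nz by simp
    have eq2: "c * moment f (2 * h) h = 2 * moment f h (2 * h)"
      using rel[OF radical_swap[OF f]] c_nz by (simp add: moment_swap)
    have "4 * (c * c) * moment f h (2 * h) = 16 * moment f h (2 * h)"
      using eq1 eq2 by Groebner_Basis.algebra
    hence "1 * moment f h (2 * h) = 16 * moment f h (2 * h)" unfolding c4 .
    hence "(3 * 5) * moment f h (2 * h) = 0" by Groebner_Basis.algebra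
    thus ?thesis using three_neq_0 five_neq_0 3 by (simp only: mult_eq_0_iff) simp
  next
    case 4
    \<comment> \<open>With these exponents the other two moments reduce to first exponents
      \<open>i - h\<close> and \<open>i\<close>, and both vanish as low moments.\<close>
    have eqs: "h - 1 + (i - h + 1) = i" "h + (h - 1) + (i - h + 1) = 2 * h + (i - h)"
      "2 * h + (h - 1) + (i - h + 1) = 2 * h + i" using 4 h_gt_2 by auto
    have "sbinom (h - 1) * sbinom (i - h + 1) * moment f i (2 * h)
        - (sbinom (h - 1) + sbinom (i - h + 1)) * moment f (2 * h + (i - h)) h
          + moment f (2 * h + i) 0 = 0"
      using moment_mixed_mixed[OF f, of "h - 1" "i - h + 1"] 4 assms(2) unfolding eqs by simp
    moreover have "i - h > 0" "i > 0" using 4 by simp_all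
    ultimately have "sbinom (h - 1) * sbinom (i - h + 1) * moment f i (2 * h) = 0"
      using 4 assms(2) unfolding moment_reduce_fst[OF \<open>i - h > 0\<close>] moment_reduce_fst[OF \<open>i > 0\<close>]
      by (simp add: moment_eq_0_low[OF f])
    thus ?thesis using sbinom_neq_0[of "h - 1"] sbinom_neq_0[of "i - h + 1"] 4 assms(2) by simp
  qed
qed

text \<open>In \<open>moment_mixed_swap\<close> with \<open>d = e = h - 1\<close> the middle terms
  reduce to low moments, leaving the factor c^2 + 1 with c = 1/2 again.\<close>

lemma moment_2h_minus_1_2h_minus_1:
  assumes f: "f \<in> radical"
  shows "moment f (2 * h - 1) (2 * h - 1) = 0"
proof -
  have eqs: "h - 1 + h = 2 * h - 1" "h + (h - 1) = 2 * h - 1" and pos: "h - 1 > 0"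
    using h_gt_2 by auto
  have "sbinom (h - 1) * sbinom (h - 1) * moment f (2 * h - 1) (2 * h - 1)
      + moment f (2 * h - 1) (2 * h - 1) = 0"
    using moment_mixed_swap[OF f, of "h - 1" "h - 1"] h_gt_2
    unfolding eqs moment_reduce_fst[OF pos] moment_reduce_snd[OF pos]
    by (simp add: moment_eq_0_low[OF f])
  hence "(4 * (sbinom (h - 1) * sbinom (h - 1)) + 4) * moment f (2 * h - 1) (2 * h - 1) = 0"
    by Groebner_Basis.algebra
  thus ?thesis using five_neq_0 unfolding four_sbinom by simp
qed

text \<open>The previous cases and their swaps cover every pair of exponents except the three in
  \<open>top\<close>, one for each of the functions 1, \<open>fst\<close> and
  \<open>snd\<close>.\<close>

lemma moment_eq_0:
  assumes f: "f \<in> radical" and i: "i \<le> 2 * h" and j: "j \<le> 2 * h"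
    and top: "moment f (2 * h) (2 * h) = 0" "moment f (2 * h - 1) (2 * h) = 0"
      "moment f (2 * h) (2 * h - 1) = 0"
  shows "moment f i j = 0"
proof -
  have split: "k \<le> 2 * h - 2 \<or> k = 2 * h - 1 \<or> k = 2 * h" if "k \<le> 2 * h" for k
    using that by auto
  have swap: "moment f (2 * h) k = 0" "moment f (2 * h - 1) k = 0" if "k \<le> 2 * h - 2" for k
    using moment_2h[OF radical_swap[OF f] that] moment_2h_minus_1[OF radical_swap[OF f] that]
    by (simp_all add: moment_swap)
  from split[OF i] split[OF j] show ?thesis
    by (elim disjE) (simp_all add: top swap moment_eq_0_low[OF f] moment_2h[OF f]
        moment_2h_minus_1[OF f] moment_2h_minus_1_2h_minus_1[OF f] del: One_nat_def)
qed

section \<open>Functions in the radical are affine\<close>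

lemma eq_0_of_moments:
  assumes "\<And>i j. i \<le> 2 * h \<Longrightarrow> j \<le> 2 * h \<Longrightarrow> moment f i j = 0"
  shows "f P = 0"
proof -
  have "\<exists>k. \<forall>x. (if x = a then 1 else 0) = (\<Sum>i\<le>2 * h. k i * x ^ i)" for a :: 'a
  proof -
    \<comment> \<open>The coefficients of 1 - (x - a)^(2h), which is the indicator of
      \<open>a\<close>. Products of two such polynomials express a value of \<open>f\<close> through
      moments.\<close>
    define k where "k i = (if i = 0 then 1 else 0) - of_nat (2 * h choose i) * (- a) ^ (2 * h - i)" for i
    have "(if x = a then 1 else 0) = (\<Sum>i\<le>2 * h. k i * x ^ i)" for x
    proof -
      have "(x - a) ^ (2 * h) = (\<Sum>i\<le>2 * h. of_nat (2 * h choose i) * x ^ i * (- a) ^ (2 * h - i))"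
        unfolding diff_conv_add_uminus by (rule binomial_ring)
      moreover have "(\<Sum>i\<le>2 * h. (if i = 0 then 1 else 0) * x ^ i) = 1"
        by (subst sum.mono_neutral_right[of _ "{0}"]) auto
      moreover have "(\<Sum>i\<le>2 * h. k i * x ^ i) = (\<Sum>i\<le>2 * h. (if i = 0 then 1 else 0) * x ^ i)
          - (\<Sum>i\<le>2 * h. of_nat (2 * h choose i) * x ^ i * (- a) ^ (2 * h - i))"
        by (simp only: k_def left_diff_distrib sum_subtractf) (simp only: mult_ac)
      ultimately have "(\<Sum>i\<le>2 * h. k i * x ^ i) = 1 - (x - a) ^ (2 * h)"
        by simp
      also have "\<dots> = (if x = a then 1 else 0)"
        using power_card_minus_1[of "x - a"] card_UNIV h_gt_2 by simp
      finally show ?thesis by simp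
    qed
    thus ?thesis by blast
  qed
  then obtain k where k: "(if x = a then 1 else 0) = (\<Sum>i\<le>2 * h. k a i * x ^ i)" for x a :: 'a
    by metis
  obtain a b where P: "P = (a, b)" by (cases P)
  have "f P = (\<Sum>Q\<in>UNIV. f Q * (if Q = P then 1 else 0))"
    by (simp add: if_distrib cong: if_cong)
  also have "\<dots> = (\<Sum>Q\<in>UNIV. f Q * ((if fst Q = a then 1 else 0) * (if snd Q = b then 1 else 0)))"
    by (intro sum.cong refl) (auto simp: P prod_eq_iff)
  also have "\<dots> = (\<Sum>Q\<in>UNIV. \<Sum>i\<le>2 * h. \<Sum>j\<le>2 * h. k a i * k b j * (f Q * monomial i j Q))"
    unfolding k sum_product by (simp only: sum_distrib_left monomial_def mult_ac)
  also have "\<dots> = (\<Sum>i\<le>2 * h. \<Sum>Q\<in>UNIV. \<Sum>j\<le>2 * h. k a i * k b j * (f Q * monomial i j Q))"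
    by (rule sum.swap)
  also have "\<dots> = (\<Sum>i\<le>2 * h. \<Sum>j\<le>2 * h. \<Sum>Q\<in>UNIV. k a i * k b j * (f Q * monomial i j Q))"
    by (intro sum.cong refl sum.swap)
  also have "\<dots> = (\<Sum>i\<le>2 * h. \<Sum>j\<le>2 * h. k a i * k b j * moment f i j)"
    by (simp add: moment_def sum_distrib_left)
  also have "\<dots> = 0" using assms by (intro sum.neutral ballI) simp
  finally show ?thesis .
qed

lemma moment_affine:
  "moment (\<lambda>P. f P + a * g P) i j = moment f i j + a * moment g i j"
  by (simp add: moment_def sum.distrib sum_distrib_left algebra_simps)

lemma radical_affine:
  assumes f: "f \<in> radical"
  obtains \<alpha> \<beta> \<gamma> where "\<And>P. f P = \<alpha> + \<beta> * fst P + \<gamma> * snd P"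
proof -
  have m1: "moment (\<lambda>_. 1) i j = (\<Sum>x\<in>UNIV. x ^ i) * (\<Sum>y\<in>UNIV. y ^ j)" for i j
    by (simp add: moment_def sum_monomial)
  have mf: "moment fst i j = (\<Sum>x\<in>UNIV. x ^ (i + 1)) * (\<Sum>y\<in>UNIV. y ^ j)" for i j
    unfolding sum_monomial[symmetric] by (simp add: moment_def monomial_def mult_ac)
  have ms: "moment snd i j = (\<Sum>x\<in>UNIV. x ^ i) * (\<Sum>y\<in>UNIV. y ^ (j + 1))" for i j
    unfolding sum_monomial[symmetric] by (simp add: moment_def monomial_def mult_ac)
  \<comment> \<open>The functions 1, \<open>fst\<close>, \<open>snd\<close> are dual to these three
    moments: each has value 1 at its own and 0 at the other two. So subtracting the affine function
    with these coefficients clears all three.\<close>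
  define \<alpha> \<beta> \<gamma> where "\<alpha> = moment f (2 * h) (2 * h)" "\<beta> = moment f (2 * h - 1) (2 * h)"
    "\<gamma> = moment f (2 * h) (2 * h - 1)"
  define g where "g = (\<lambda>P. ((f P + (- \<alpha>) * 1) + (- \<beta>) * fst P) + (- \<gamma>) * snd P)"
  have g: "g \<in> radical"
    unfolding g_def
    by (intro radical_add f one_in_radical fst_in_radical snd_in_radical)
  have g_moment: "moment g i j = moment f i j + (- \<alpha>) * moment (\<lambda>_. 1) i j
      + (- \<beta>) * moment fst i j + (- \<gamma>) * moment snd i j" for i j
    unfolding g_def by (simp only: moment_affine)
  have h: "2 * h - 1 + 1 = 2 * h" "2 * h - 1 < 2 * h" using h_gt_2 by auto
  have "g P = 0" for P
  proof (rule eq_0_of_moments, rule moment_eq_0[OF g])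
    show "moment g (2 * h) (2 * h) = 0" "moment g (2 * h - 1) (2 * h) = 0"
      "moment g (2 * h) (2 * h - 1) = 0"
      unfolding g_moment m1 mf ms h(1) sum_power_2h sum_power_2h_plus_1 sum_power_less[OF h(2)]
      by (simp_all add: \<alpha>_\<beta>_\<gamma>_def)
  qed
  hence "f P = \<alpha> + \<beta> * fst P + \<gamma> * snd P" for P
    by (simp add: g_def algebra_simps add_eq_0_iff)
  thus ?thesis using that by blast
qed

text \<open>Both coordinate functions lie in the radical, hence so do their compositions with
  \<phi>.\<close>

lemma kern_automorphism_affine:
  assumes "bij \<phi>" "\<And>P Q. kern (\<phi> P) (\<phi> Q) = kern P Q"
  obtains \<alpha> \<beta> \<gamma> \<alpha>' \<beta>' \<gamma>' where
    "\<And>x y. \<phi> (x, y) = (\<alpha> + \<beta> * x + \<gamma> * y, \<alpha>' + \<beta>' * x + \<gamma>' * y)"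
proof -
  obtain \<alpha> \<beta> \<gamma> where 1: "(fst \<circ> \<phi>) P = \<alpha> + \<beta> * fst P + \<gamma> * snd P" for P
    using radical_affine[OF radical_comp[OF fst_in_radical assms]] by blast
  obtain \<alpha>' \<beta>' \<gamma>' where 2: "(snd \<circ> \<phi>) P = \<alpha>' + \<beta>' * fst P + \<gamma>' * snd P" for P
    using radical_affine[OF radical_comp[OF snd_in_radical assms]] by blast
  have "\<phi> (x, y) = (\<alpha> + \<beta> * x + \<gamma> * y, \<alpha>' + \<beta>' * x + \<gamma>' * y)" for x y
    using 1[of "(x, y)"] 2[of "(x, y)"] by (simp add: prod_eq_iff)
  thus ?thesis using that by blast
qed

end

section \<open>Transfer to isotropic coordinates\<close>

theorem integral_automorphism_prime_card_1_mod_4: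
  fixes \<phi> :: "'a::{field,finite} \<times> 'a \<Rightarrow> 'a \<times> 'a"
  assumes q: "CARD('a) mod 4 = 1" "prime CARD('a)" "CARD('a) \<noteq> 5"
    and \<phi>: "\<phi> \<in> integral_automorphisms"
  shows "\<phi> \<in> plane_automorphisms"
proof (rule plane_automorphismI)
  let ?q = "CARD('a)"
  show bij: "bij \<phi>" using \<phi> by (simp add: integral_automorphisms_def)
  hence inj: "inj \<phi>" by (simp add: bij_def)
  obtain k where k: "?q = 4 * k + 1" using q by (metis mult_div_mod_eq)
  define h where "h = 2 * k"
  have qh: "?q = 2 * h + 1" using k by (simp add: h_def)
  have "k \<noteq> 1" using k q by auto
  have "k \<noteq> 0"
  proof
    assume "k = 0"
    with k q(2) show False by simp
  qed
  interpret prime_field h "TYPE('a)"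
    using q \<open>k \<noteq> 0\<close> \<open>k \<noteq> 1\<close> by unfold_locales (simp_all add: qh[symmetric] h_def k)
  have two: "(2::'a) \<noteq> 0" by (rule two_neq_0_of_odd_card) (simp add: qh)
  hence "(1::'a) \<noteq> - 1" by (metis one_add_one add.right_inverse)
  \<comment> \<open>Since \<open>h\<close> is even, \<open>(- 1) ^ h = 1\<close>, so -1 cannot be a
    nonsquare.\<close>
  hence "- 1 \<in> (squares :: 'a set)"
    using euler_criterion[OF qh, of "- 1"] even_h by (auto split: if_splits)
  then obtain j :: 'a where j: "j\<^sup>2 = - 1" by (auto simp: squares_def)
  hence j0: "j \<noteq> 0" by auto
  have four: "(4::'a) \<noteq> 0" using of_nat_neq_0[of 4] h_gt_2 by simp
  \<comment> \<open>With \<open>j\<close> a square root of -1, the coordinates x + j y and x - j y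
    multiply to the norm; \<open>D\<close> is the inverse change of coordinates.\<close>
  define E where "E = (\<lambda>(x, y). (x + j * y, x - j * y))"
  define D where "D = (\<lambda>(u, v). ((u + v) / 2, (u - v) / (2 * j)))"
  have DE: "D (E A) = A" for A
    using two four j0 by (cases A) (simp add: D_def E_def field_simps)
  have ED: "E (D A) = A" for A
    using two four j0 by (cases A) (simp add: D_def E_def field_simps)
  have inj_E: "E A = E B \<longleftrightarrow> A = B" for A B by (metis DE)
  have E_norm: "(fst (E A) - fst (E B)) * (snd (E A) - snd (E B)) = plane_norm (A - B)" for A B
  proof -
    obtain a b c d where AB: "A = (a, b)" "B = (c, d)" by (metis surj_pair)
    have "(fst (E A) - fst (E B)) * (snd (E A) - snd (E B)) = (a - c)\<^sup>2 - j\<^sup>2 * (b - d)\<^sup>2"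
      by (simp add: AB E_def power2_eq_square algebra_simps)
    thus ?thesis by (simp add: AB j)
  qed
  \<comment> \<open>For distinct points at norm zero exactly one coordinate agrees, and its
    indicator supplies the value 1 that the vanishing \<open>h\<close>-th power lacks.\<close>
  have kern_E: "kern (E A) (E B) = (if A = B then 2 else if integral_distance A B then 1 else - 1)"
    for A B
  proof (cases "A = B")
    case True
    thus ?thesis using h_gt_2 by (simp add: kern_def power_0_left)
  next
    case False
    show ?thesis
    proof (cases "plane_norm (A - B) = 0")
      case True
      hence "fst (E A) = fst (E B) \<or> snd (E A) = snd (E B)"
        unfolding E_norm[symmetric] by auto
      moreover have "\<not> (fst (E A) = fst (E B) \<and> snd (E A) = snd (E B))"
        using False inj_E by (simp add: prod_eq_iff[symmetric])
      moreover have "(0::'a) \<in> squares" by (auto simp: squares_def intro: range_eqI[of _ _ 0])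
      ultimately show ?thesis
        using False True h_gt_2 unfolding kern_def E_norm integral_distance_def
        by (auto simp: power_0_left)
    next
      case nz: False
      hence "fst (E A) \<noteq> fst (E B)" "snd (E A) \<noteq> snd (E B)"
        unfolding E_norm[symmetric] by auto
      thus ?thesis
        using False euler_criterion[OF qh nz] unfolding kern_def E_norm integral_distance_def
        by simp
    qed
  qed
  define \<psi> where "\<psi> = E \<circ> \<phi> \<circ> D"
  have "bij D" by (rule bij_betw_byWitness[of _ E]) (auto simp: DE ED)
  moreover have "bij E" by (rule bij_betw_byWitness[of _ D]) (auto simp: DE ED)
  ultimately have "bij \<psi>" unfolding \<psi>_def using bij by (intro bij_comp)
  moreover have "kern (\<psi> A) (\<psi> B) = kern A B" for A B
  proof -
    have "kern (\<psi> A) (\<psi> B) = kern (E (D A)) (E (D B))"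
      unfolding \<psi>_def o_apply kern_E
      by (simp add: inj_eq[OF inj] integral_automorphism_iff[OF \<phi>])
    thus ?thesis by (simp add: ED)
  qed
  ultimately obtain \<alpha> \<beta> \<gamma> \<alpha>' \<beta>' \<gamma>' where
    affine: "\<And>x y. \<psi> (x, y) = (\<alpha> + \<beta> * x + \<gamma> * y, \<alpha>' + \<beta>' * x + \<gamma>' * y)"
    by (rule kern_automorphism_affine) blast
  have E_\<phi>: "E (\<phi> A) = \<psi> (E A)" for A by (simp add: \<psi>_def DE)
  fix P V :: "'a \<times> 'a"
  have "\<phi> (P + scale t V) = \<phi> P + scale t (\<phi> (P + V) - \<phi> P)" for t
  proof -
    have E_affine: "E (A + scale s (B - C)) = E A + scale s (E B - E C)" for A B C s
      by (cases A; cases B; cases C) (simp add: E_def scale_def algebra_simps)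
    have \<psi>_affine: "\<psi> (A + scale t (B - A)) = \<psi> A + scale t (\<psi> B - \<psi> A)" for A B
      by (cases A; cases B) (simp add: affine scale_def algebra_simps)
    \<comment> \<open>Writing \<open>V\<close> as \<open>P + V - P\<close> puts the point in the
      form \<open>A + scale t (B - A)\<close>, which affine maps respect.\<close>
    have "E (\<phi> (P + scale t (P + V - P))) = E (\<phi> P + scale t (\<phi> (P + V) - \<phi> P))"
      by (simp only: E_\<phi> E_affine \<psi>_affine)
    thus ?thesis by (simp add: inj_E)
  qed
  thus "\<exists>V'. \<forall>t. \<exists>s. \<phi> (P + scale t V) = \<phi> P + scale s V'" by blast
qed

theorem theorem1:
  fixes q :: nat
  assumes "CARD('a::{field,finite}) = q"
    and "odd q"
    and "q mod 4 = 3 \<or> (prime q \<and> q \<noteq> 5)"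
  shows "(integral_automorphisms :: ('a \<times> 'a \<Rightarrow> 'a \<times> 'a) set) = affine_integral_automorphisms"
proof -
  \<comment> \<open>In residue class 1 the assumption forces \<open>q\<close> to be a prime other
    than 5.\<close>
  have "q mod 4 = 1 \<or> q mod 4 = 3" using \<open>odd q\<close> by presburger
  hence "\<phi> \<in> plane_automorphisms" if "\<phi> \<in> integral_automorphisms" for \<phi> :: "'a \<times> 'a \<Rightarrow> 'a \<times> 'a"
    using assms that integral_automorphism_card_3_mod_4[of \<phi>]
      integral_automorphism_prime_card_1_mod_4[of \<phi>] by auto
  thus ?thesis by (auto simp: affine_integral_automorphisms_def)
qed

end
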